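(* Let $0<\alpha<2$. A real, measurable, stationary S$\alpha$S random field $\{X_t\}_{t\in\mathbb T^d}$ is ergodic if and only if it is weakly mixing.
   Context: $\mathbb T\in\{\mathbb Z,\mathbb R\}$; $\lambda$ counting or Lebesgue measure on $\mathbb T^d$; $B(T)=(-T,T]^d\cap\mathbb T^d$, $C(T)=(2T)^d$; $\|t\|=\max_i|t_i|$. Write $X_t=X_0\circ\theta_t$ with $\{\theta_t\}$ a measure-preserving $\mathbb T^d$-action on $(\Omega,\mathcal F,\mathbb P)$, $\sigma_X=\sigma(X_t:t\in\mathbb T^d)$. Ergodic: $\lim_T\frac1{C(T)}\int_{B(T)}\mathbb P(A\cap\theta_t(B))\lambda(dt)=\mathbb P(A)\mathbb P(B)$ for all $A,B\in\sigma_X$. A set $E\subset\mathbb T^d$ has density zero if $\lim_T\frac1{C(T)}\int_{B(T)}\mathbf 1_E\,d\lambda=0$; $D$ has density one if $\mathbb T^d\setminus D$ has density zero; $\mathcal T_D$ is the set of sequences $(t_n)\subset D$ with $\|t_n\|\to\infty$. Weakly mixing: there is a density-one set $D$ with $\lim_n\mathbb P(A\cap\theta_{t_n}(B))=\mathbb P(A)\mathbb P(B)$ for all $A,B\in\sigma_X$ and all $(t_n)\in\mathcal T_D$. *)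

theory Defs
  imports "HOL-Analysis.Analysis" "HOL-Probability.Probability"
begin

text \<open>Index set T^d inside real^'d: discr = True gives Z^d, discr = False gives R^d.\<close>
definition Tset :: "bool \<Rightarrow> (real^'d) set" where
  "Tset discr = (if discr then {t. \<forall>i. t$i \<in> \<int>} else UNIV)"

definition lam :: "bool \<Rightarrow> (real^'d) measure" where
  "lam discr = (if discr then count_space (Tset discr) else lebesgue)"

definition idx_space :: "bool \<Rightarrow> (real^'d) measure" where
  "idx_space discr = (if discr then count_space (Tset discr) else borel)"

definition Bbox :: "bool \<Rightarrow> real \<Rightarrow> (real^'d) set" where
  "Bbox discr T = {t \<in> Tset discr. \<forall>i. - T < t$i \<and> t$i \<le> T}"

definition Cvol :: "'d::finite itself \<Rightarrow> real \<Rightarrow> real" where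
  "Cvol _ T = (2 * T) ^ CARD('d)"

definition maxnorm :: "real^'d \<Rightarrow> real" where
  "maxnorm t = Max (range (\<lambda>i. \<bar>t$i\<bar>))"

definition mp_action :: "bool \<Rightarrow> 'a measure \<Rightarrow> (real^'d \<Rightarrow> 'a \<Rightarrow> 'a) \<Rightarrow> bool" where
  "mp_action discr M \<theta> \<longleftrightarrow>
     (\<forall>t\<in>Tset discr. \<theta> t \<in> M \<rightarrow>\<^sub>M M \<and> distr M M (\<theta> t) = M) \<and>
     (\<forall>\<omega>\<in>space M. \<theta> 0 \<omega> = \<omega>) \<and>
     (\<forall>s\<in>Tset discr. \<forall>t\<in>Tset discr. \<forall>\<omega>\<in>space M. \<theta> (s + t) \<omega> = \<theta> s (\<theta> t \<omega>))"

definition sigmaX :: "bool \<Rightarrow> 'a measure \<Rightarrow> (real^'d \<Rightarrow> 'a \<Rightarrow> real) \<Rightarrow> 'a set set" where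
  "sigmaX discr M X = sigma_sets (space M)
      (\<Union>t\<in>Tset discr. {X t -` A \<inter> space M | A. A \<in> sets borel})"

text \<open>A real random variable Y is symmetric alpha-stable (possibly degenerate at 0).\<close>
definition SaS_rv :: "real \<Rightarrow> 'a measure \<Rightarrow> ('a \<Rightarrow> real) \<Rightarrow> bool" where
  "SaS_rv \<alpha> M Y \<longleftrightarrow> (\<exists>\<sigma>\<ge>0. \<forall>u. char (distr M borel Y) u = complex_of_real (exp (- ((\<sigma> * \<bar>u\<bar>) powr \<alpha>))))"

definition SaS_field :: "bool \<Rightarrow> real \<Rightarrow> 'a measure \<Rightarrow> (real^'d \<Rightarrow> 'a \<Rightarrow> real) \<Rightarrow> bool" where
  "SaS_field discr \<alpha> M X \<longleftrightarrow>
     (\<forall>F c. finite F \<and> F \<subseteq> Tset discr \<longrightarrow> SaS_rv \<alpha> M (\<lambda>\<omega>. \<Sum>t\<in>F. c t * X t \<omega>))"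

definition density_zero :: "bool \<Rightarrow> (real^'d) set \<Rightarrow> bool" where
  "density_zero discr E \<longleftrightarrow> E \<in> sets (lam discr) \<and>
     ((\<lambda>T. (1 / Cvol TYPE('d) T) * measure (lam discr) (E \<inter> Bbox discr T)) \<longlongrightarrow> 0) at_top"

definition density_one :: "bool \<Rightarrow> (real^'d) set \<Rightarrow> bool" where
  "density_one discr D \<longleftrightarrow> D \<subseteq> Tset discr \<and> density_zero discr (Tset discr - D)"

definition ergodic_action :: "bool \<Rightarrow> 'a measure \<Rightarrow> (real^'d \<Rightarrow> 'a \<Rightarrow> 'a) \<Rightarrow> (real^'d \<Rightarrow> 'a \<Rightarrow> real) \<Rightarrow> bool" where
  "ergodic_action discr M \<theta> X \<longleftrightarrow>
     (\<forall>A\<in>sigmaX discr M X. \<forall>B\<in>sigmaX discr M X.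
        ((\<lambda>T. (1 / Cvol TYPE('d) T) *
            (LINT t:Bbox discr T|lam discr. measure M (A \<inter> (\<theta> t -` B \<inter> space M))))
          \<longlongrightarrow> measure M A * measure M B) at_top)"

definition weakly_mixing_action :: "bool \<Rightarrow> 'a measure \<Rightarrow> (real^'d \<Rightarrow> 'a \<Rightarrow> 'a) \<Rightarrow> (real^'d \<Rightarrow> 'a \<Rightarrow> real) \<Rightarrow> bool" where
  "weakly_mixing_action discr M \<theta> X \<longleftrightarrow>
     (\<exists>D. density_one discr D \<and>
        (\<forall>A\<in>sigmaX discr M X. \<forall>B\<in>sigmaX discr M X. \<forall>tn :: nat \<Rightarrow> real^'d.
           (\<forall>n. tn n \<in> D) \<and> filterlim (\<lambda>n. maxnorm (tn n)) at_top sequentially \<longrightarrow>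
           (\<lambda>n. measure M (A \<inter> (\<theta> (tn n) -` B \<inter> space M))) \<longlonglongrightarrow> measure M A * measure M B))"

end

theory Submission
  imports Defs
begin

text \<open>
  For a stationary S\<open>\<alpha>\<close>S field let \<open>\<phi>(Y) = E cos Y\<close> for \<open>Y\<close> in the linear span of the field. Stability
  gives \<open>E sin Y = 0\<close> and \<open>\<phi>(vY) = \<phi>(Y)\<^sup>2\<close> for \<open>v = 2 powr (1 / \<alpha>)\<close>. Under ergodicity the averages over \<open>t\<close> of
  \<open>d(t) = \<phi>(Y + Z \<circ> \<theta>\<^sub>t) - \<phi>(Y) \<phi>(Z)\<close> tend to 0, and so do those of the same expression for \<open>(vY, vZ)\<close>,
  which equals \<open>d\<^sup>2 + 2 \<phi>(Y) \<phi>(Z) d\<close>; hence the averages of \<open>d\<^sup>2\<close> tend to 0. Trigonometric polynomials in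
  the field are dense in \<open>L\<^sup>1(\<sigma>\<^sub>X)\<close>, so \<open>\<bar>P(A \<inter> \<theta>\<^sub>t\<^sup>-\<^sup>1 B) - P(A) P(B)\<bar>\<close> averages to 0 for all
  \<open>A, B\<close> in \<open>\<sigma>\<^sub>X\<close>. Joint measurability places \<open>\<sigma>\<^sub>X\<close> inside a countably generated \<open>\<sigma>\<close>-algebra, so \<open>\<sigma>\<^sub>X\<close> is
  separable in measure and a Koopman--von Neumann argument for countably many pairs \<open>A, B\<close> yields one
  density-one set that serves all of them.
\<close>

section \<open>Averages over boxes\<close>

text \<open>Ergodicity controls only signed averages of correlations, while weak mixing amounts to
  vanishing averages of their absolute values; cancellation could hide the difference. Stability
  supplies a second signed relation, and the two combine to an average of squares. Two features make
  this work. The law of every linear combination is symmetric, so \<open>d\<close> is real and its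
  square nonnegative; and the span is invariant under shifts, so
  \<open>Y + Z \<circ> \<theta>\<^sub>t\<close> is itself stable and obeys the scaling law. The
  second obstacle is the order of quantifiers: one set \<open>D\<close> must serve all pairs of
  events, although for index set R^d the field has uncountably many coordinates. Separability is
  claimed for the measure of the symmetric difference, because a sub-sigma-algebra of a countably
  generated one need not be countably generated. Joint measurability is used a second time: it makes
  correlations measurable in \<open>t\<close>, so that the averages are genuine integrals.\<close>

definition avg :: "bool \<Rightarrow> real \<Rightarrow> (real^'d \<Rightarrow> real) \<Rightarrow> real" where
  "avg discr T f = (1 / Cvol TYPE('d) T) * (LINT t:Bbox discr T|lam discr. f t)"

definition bdd_meas :: "bool \<Rightarrow> (real^'d \<Rightarrow> real) \<Rightarrow> bool" where
  "bdd_meas discr f \<longleftrightarrow> f \<in> borel_measurable (lam discr) \<and> (\<exists>K. \<forall>t\<in>Tset discr. \<bar>f t\<bar> \<le> K)"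

lemma space_lam [simp]: "space (lam discr) = Tset discr"
  by (auto simp: lam_def Tset_def)

lemma Bbox_subset: "Bbox discr T \<subseteq> Tset discr"
  by (auto simp: Bbox_def)

lemma Bbox_mono:
  assumes "S \<le> T" shows "Bbox discr S \<subseteq> Bbox discr T"
proof
  fix t assume t: "t \<in> Bbox discr S"
  then have "- T < t$i" "t$i \<le> T" for i using assms by (auto simp: Bbox_def dest!: spec[of _ i])
  with t show "t \<in> Bbox discr T" by (simp add: Bbox_def)
qed

lemma Cvol_pos: "T > 0 \<Longrightarrow> Cvol TYPE('d::finite) T > 0"
  by (simp add: Cvol_def)

section \<open>Cardinality and volume of the boxes\<close>

lemma card_ints_half_open:
  fixes T :: real assumes "T > 0"
  shows "finite {x \<in> \<int>. - T < x \<and> x \<le> T}"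
    and "real (card {x \<in> \<int>. - T < x \<and> x \<le> T}) = of_int (\<lfloor>T\<rfloor> - \<lfloor>- T\<rfloor>)"
proof -
  have eq: "{x \<in> \<int>. - T < x \<and> x \<le> T} = real_of_int ` {\<lfloor>- T\<rfloor> <.. \<lfloor>T\<rfloor>}"
  proof (intro equalityI subsetI)
    fix x assume "x \<in> {x \<in> \<int>. - T < x \<and> x \<le> T}"
    then obtain k where "x = of_int k" "- T < of_int k" "of_int k \<le> T" by (auto elim: Ints_cases)
    then show "x \<in> real_of_int ` {\<lfloor>- T\<rfloor> <.. \<lfloor>T\<rfloor>}" by (auto simp: floor_less_iff le_floor_iff)
  qed (auto simp: floor_less_iff le_floor_iff)
  show "finite {x \<in> \<int>. - T < x \<and> x \<le> T}" unfolding eq by simp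
  have "\<lfloor>- T\<rfloor> \<le> \<lfloor>T\<rfloor>" using assms by (intro floor_mono) simp
  then show "real (card {x \<in> \<int>. - T < x \<and> x \<le> T}) = of_int (\<lfloor>T\<rfloor> - \<lfloor>- T\<rfloor>)"
    unfolding eq by (subst card_image) (auto simp: inj_on_def)
qed

lemma card_Bbox_discr:
  fixes T :: real assumes "T > 0"
  shows "finite (Bbox True T :: (real^'d) set)"
    and "real (card (Bbox True T :: (real^'d) set)) = of_int (\<lfloor>T\<rfloor> - \<lfloor>- T\<rfloor>) ^ CARD('d)"
proof -
  let ?J = "{x \<in> \<int>. - T < x \<and> x \<le> T}"
  have eq: "(Bbox True T :: (real^'d) set) = vec_lambda ` (UNIV \<rightarrow>\<^sub>E ?J)"
  proof (intro equalityI subsetI)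
    fix t :: "real^'d" assume "t \<in> Bbox True T"
    then have "vec_nth t \<in> UNIV \<rightarrow>\<^sub>E ?J" by (simp add: Bbox_def Tset_def PiE_iff)
    then show "t \<in> vec_lambda ` (UNIV \<rightarrow>\<^sub>E ?J)" by (intro image_eqI[of _ _ "vec_nth t"]) simp_all
  next
    fix t :: "real^'d" assume "t \<in> vec_lambda ` (UNIV \<rightarrow>\<^sub>E ?J)"
    then show "t \<in> Bbox True T" by (clarsimp simp: Bbox_def Tset_def PiE_iff)
  qed
  show "finite (Bbox True T :: (real^'d) set)"
    unfolding eq by (intro finite_imageI finite_PiE) (auto simp: card_ints_half_open(1)[OF assms])
  have "card (Bbox True T :: (real^'d) set) = card ((UNIV :: 'd set) \<rightarrow>\<^sub>E ?J)"
    unfolding eq by (intro card_image inj_onI) (simp add: vec_lambda_inject)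
  also have "\<dots> = card ?J ^ CARD('d)" by (simp add: card_PiE)
  finally show "real (card (Bbox True T :: (real^'d) set)) = of_int (\<lfloor>T\<rfloor> - \<lfloor>- T\<rfloor>) ^ CARD('d)"
    using card_ints_half_open(2)[OF assms] by simp
qed

lemma cbox_const_eq: "cbox (\<chi> i. a) (\<chi> i. b) = {t :: real^'d. \<forall>i. a \<le> t$i \<and> t$i \<le> b}"
  by (auto simp: mem_box_cart)

lemma box_const_eq: "box (\<chi> i. a) (\<chi> i. b) = {t :: real^'d. \<forall>i. a < t$i \<and> t$i < b}"
  by (auto simp: mem_box_cart)

lemma Bbox_in_borel: "(Bbox False T :: (real^'d) set) \<in> sets borel"
proof -
  have "(Bbox False T :: (real^'d) set) = (\<Inter>i. {t. - T < t$i} \<inter> {t. t$i \<le> T})"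
    by (auto simp: Bbox_def Tset_def)
  also have "\<dots> \<in> sets borel"
    by (intro sets.finite_INT sets.Int borel_open borel_closed open_halfspace_component_gt_cart
        closed_halfspace_component_le_cart) auto
  finally show ?thesis .
qed

text \<open>The half-open box lies between the open and the closed box, whose volumes agree.\<close>

lemma emeasure_Bbox_cont:
  assumes "T > 0"
  shows "emeasure lebesgue (Bbox False T :: (real^'d) set) = ennreal ((2 * T) ^ CARD('d))"
proof -
  have sub1: "box (\<chi> i. - T) (\<chi> i. T) \<subseteq> (Bbox False T :: (real^'d) set)"
    and sub2: "(Bbox False T :: (real^'d) set) \<subseteq> cbox (\<chi> i. - T) (\<chi> i. T)"
    by (auto simp: Bbox_def Tset_def box_const_eq cbox_const_eq less_imp_le)
  have ne: "cbox (\<chi> i. - T) (\<chi> i. T) \<noteq> ({} :: (real^'d) set)"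
    using assms by (auto simp: interval_ne_empty_cart)
  have c: "measure lborel (cbox (\<chi> i. - T) (\<chi> i. T) :: (real^'d) set) = (2 * T) ^ CARD('d)"
    using content_cbox_cart[OF ne] by simp
  have 1: "emeasure lebesgue (cbox (\<chi> i. - T) (\<chi> i. T) :: (real^'d) set) = ennreal ((2 * T) ^ CARD('d))"
    by (simp add: emeasure_eq_ennreal_measure c emeasure_lborel_cbox_eq del: power_mult_distrib content_cbox_cart)
  have 2: "emeasure lebesgue (box (\<chi> i. - T) (\<chi> i. T) :: (real^'d) set) = ennreal ((2 * T) ^ CARD('d))"
    using 1 by (simp add: emeasure_lborel_cbox_eq emeasure_lborel_box_eq)
  have "(Bbox False T :: (real^'d) set) \<in> sets lebesgue" using Bbox_in_borel[of T, where ?'d='d] by simp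
  then show ?thesis
    using emeasure_mono[OF sub1, of lebesgue] emeasure_mono[OF sub2, of lebesgue] 1 2 by (simp add: antisym)
qed

lemma Bbox_sets [measurable, simp]: "Bbox discr T \<in> sets (lam discr)"
  using Bbox_in_borel[of T] Bbox_subset[of discr T] by (cases discr) (auto simp: lam_def sets_completionI_sets)

lemma Bbox_emeasure_finite:
  assumes "T > 0" shows "emeasure (lam discr) (Bbox discr T :: (real^'d) set) < \<infinity>"
  using emeasure_Bbox_cont[OF assms, where ?'d='d] card_Bbox_discr(1)[OF assms, where ?'d='d]
    Bbox_subset[of discr T, where ?'a='d]
  by (cases discr) (auto simp: lam_def ennreal_of_nat_eq_real_of_nat)

text \<open>On the lattice the normaliser is only asymptotically the number of points: the count per
  axis differs from \<open>2 * T\<close> by at most 2. For this reason averages of constants are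
  treated as limits throughout, never as equalities.\<close>

lemma measure_Bbox_tendsto:
  "((\<lambda>T. (1 / Cvol TYPE('d::finite) T) * measure (lam discr) (Bbox discr T :: (real^'d) set)) \<longlongrightarrow> 1) at_top"
proof (cases discr)
  case True
  have "((\<lambda>T. real_of_int (\<lfloor>T\<rfloor> - \<lfloor>- T\<rfloor>) / (2 * T)) \<longlongrightarrow> (1::real)) at_top"
  proof (rule tendsto_sandwich)
    show "\<forall>\<^sub>F T in at_top. 1 - 1 / T \<le> real_of_int (\<lfloor>T\<rfloor> - \<lfloor>- T\<rfloor>) / (2 * T)"
      using eventually_gt_at_top[of 0]
    proof eventually_elim
      case (elim T)
      have "2 * T - 2 \<le> real_of_int (\<lfloor>T\<rfloor> - \<lfloor>- T\<rfloor>)" by linarith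
      then have "(2 * T - 2) / (2 * T) \<le> real_of_int (\<lfloor>T\<rfloor> - \<lfloor>- T\<rfloor>) / (2 * T)"
        using elim by (intro divide_right_mono) auto
      moreover have "(2 * T - 2) / (2 * T) = 1 - 1 / T" using elim by (simp add: field_simps)
      ultimately show ?case by simp
    qed
    show "\<forall>\<^sub>F T in at_top. real_of_int (\<lfloor>T\<rfloor> - \<lfloor>- T\<rfloor>) / (2 * T) \<le> 1 + 1 / T"
      using eventually_gt_at_top[of 0]
    proof eventually_elim
      case (elim T)
      have "real_of_int (\<lfloor>T\<rfloor> - \<lfloor>- T\<rfloor>) \<le> 2 * T + 2" by linarith
      then have "real_of_int (\<lfloor>T\<rfloor> - \<lfloor>- T\<rfloor>) / (2 * T) \<le> (2 * T + 2) / (2 * T)"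
        using elim by (intro divide_right_mono) auto
      moreover have "(2 * T + 2) / (2 * T) = 1 + 1 / T" using elim by (simp add: field_simps)
      ultimately show ?case by simp
    qed
    have "((\<lambda>T. 1 - 1 / T) \<longlongrightarrow> 1 - (0::real)) at_top" "((\<lambda>T. 1 + 1 / T) \<longlongrightarrow> 1 + (0::real)) at_top"
      by (intro tendsto_intros tendsto_divide_0[OF tendsto_const] filterlim_at_top_imp_at_infinity filterlim_ident)+
    then show "((\<lambda>T. 1 - 1 / T) \<longlongrightarrow> (1::real)) at_top" "((\<lambda>T. 1 + 1 / T) \<longlongrightarrow> (1::real)) at_top"
      by simp_all
  qed
  then have "((\<lambda>T. (real_of_int (\<lfloor>T\<rfloor> - \<lfloor>- T\<rfloor>) / (2 * T)) ^ CARD('d)) \<longlongrightarrow> (1::real) ^ CARD('d)) at_top"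
    by (rule tendsto_power)
  moreover have "\<forall>\<^sub>F T in at_top. (real_of_int (\<lfloor>T\<rfloor> - \<lfloor>- T\<rfloor>) / (2 * T)) ^ CARD('d)
     = (1 / Cvol TYPE('d) T) * measure (lam discr) (Bbox discr T :: (real^'d) set)"
    using eventually_gt_at_top[of 0]
  proof eventually_elim
    case (elim T)
    have "measure (lam discr) (Bbox discr T :: (real^'d) set) = real (card (Bbox discr T :: (real^'d) set))"
      using True card_Bbox_discr(1)[OF elim, where ?'d='d] Bbox_subset[of True T, where ?'a='d]
      by (simp add: lam_def measure_count_space)
    then show ?case using True card_Bbox_discr(2)[OF elim, where ?'d='d]
      by (simp add: Cvol_def power_divide)
  qed
  ultimately show ?thesis by (auto elim: Lim_transform_eventually)
next
  case False
  have "\<forall>\<^sub>F T in at_top. 1 = (1 / Cvol TYPE('d) T) * measure (lam discr) (Bbox discr T :: (real^'d) set)"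
    using eventually_gt_at_top[of 0]
  proof eventually_elim
    case (elim T)
    then show ?case using False emeasure_Bbox_cont[OF elim, where ?'d='d]
      by (simp add: lam_def measure_def Cvol_def)
  qed
  then show ?thesis by (rule Lim_transform_eventually[OF tendsto_const])
qed

section \<open>Averages of bounded measurable functions\<close>

lemma bdd_measD: "bdd_meas discr f \<Longrightarrow> f \<in> borel_measurable (lam discr)"
  by (simp add: bdd_meas_def)

lemma bdd_meas_const [simp]: "bdd_meas discr (\<lambda>t. c)"
  by (auto simp: bdd_meas_def)

lemma bdd_meas_abs: "bdd_meas discr f \<Longrightarrow> bdd_meas discr (\<lambda>t. \<bar>f t\<bar>)"
  by (auto simp: bdd_meas_def)

lemma bdd_meas_add:
  assumes "bdd_meas discr f" "bdd_meas discr g" shows "bdd_meas discr (\<lambda>t. f t + g t)"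
proof -
  obtain K L where "\<And>t. t \<in> Tset discr \<Longrightarrow> \<bar>f t\<bar> \<le> K" "\<And>t. t \<in> Tset discr \<Longrightarrow> \<bar>g t\<bar> \<le> L"
    using assms by (auto simp: bdd_meas_def)
  then have "\<forall>t\<in>Tset discr. \<bar>f t + g t\<bar> \<le> K + L" by (intro ballI abs_triangle_ineq[THEN order_trans] add_mono) auto
  with assms show ?thesis by (auto simp: bdd_meas_def)
qed

lemma bdd_meas_mult:
  assumes "bdd_meas discr f" "bdd_meas discr g" shows "bdd_meas discr (\<lambda>t. f t * g t)"
proof -
  obtain K L where "\<And>t. t \<in> Tset discr \<Longrightarrow> \<bar>f t\<bar> \<le> K" "\<And>t. t \<in> Tset discr \<Longrightarrow> \<bar>g t\<bar> \<le> L"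
    using assms by (auto simp: bdd_meas_def)
  then have "\<forall>t\<in>Tset discr. \<bar>f t * g t\<bar> \<le> \<bar>K\<bar> * \<bar>L\<bar>" unfolding abs_mult
    by (intro ballI mult_mono) (auto intro: order_trans[OF _ abs_ge_self])
  with assms show ?thesis by (auto simp: bdd_meas_def)
qed

lemma bdd_meas_indicator: "E \<in> sets (lam discr) \<Longrightarrow> bdd_meas discr (indicator E)"
  by (auto simp: bdd_meas_def indicator_def intro!: exI[of _ 1])

lemma set_integrable_Bbox:
  fixes f :: "real^'d \<Rightarrow> real"
  assumes "bdd_meas discr f" "T > 0"
  shows "set_integrable (lam discr) (Bbox discr T) f"
proof -
  obtain K where K: "\<And>t. t \<in> Tset discr \<Longrightarrow> \<bar>f t\<bar> \<le> K"
    using assms by (auto simp: bdd_meas_def)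
  show ?thesis unfolding set_integrable_def
  proof (rule Bochner_Integration.integrable_bound)
    show "integrable (lam discr) (\<lambda>t. \<bar>K\<bar> * indicat_real (Bbox discr T) t)"
      using Bbox_emeasure_finite[OF assms(2), of discr]
      by (intro integrable_mult_right integrable_real_indicator) auto
    show "(\<lambda>t. indicat_real (Bbox discr T) t *\<^sub>R f t) \<in> borel_measurable (lam discr)"
      using bdd_measD[OF assms(1)] by measurable
    show "AE t in lam discr. norm (indicat_real (Bbox discr T) t *\<^sub>R f t) \<le> norm (\<bar>K\<bar> * indicat_real (Bbox discr T) t)"
      using K by (intro AE_I2) (auto simp: indicator_def abs_mult intro: order_trans[OF _ abs_ge_self])
  qed
qed

lemma avg_add:
  "bdd_meas discr f \<Longrightarrow> bdd_meas discr g \<Longrightarrow> T > 0 \<Longrightarrow>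
    avg discr T (\<lambda>t. f t + g t) = avg discr T f + avg discr T g"
  unfolding avg_def by (subst set_integral_add) (auto intro: set_integrable_Bbox simp: algebra_simps)

lemma avg_cmult: "avg discr T (\<lambda>t. c * f t) = c * avg discr T f"
  unfolding avg_def by (subst set_integral_mult_right) simp

lemma avg_mono:
  fixes f g :: "real^'d \<Rightarrow> real"
  assumes "bdd_meas discr f" "bdd_meas discr g" "T > 0" "\<And>t. t \<in> Bbox discr T \<Longrightarrow> f t \<le> g t"
  shows "avg discr T f \<le> avg discr T g"
  unfolding avg_def using assms Cvol_pos[OF assms(3), where ?'d='d]
  by (intro mult_left_mono set_integral_mono set_integrable_Bbox) auto

lemma avg_indicator:
  fixes E :: "(real^'d) set"
  shows "avg discr T (indicator E) = (1 / Cvol TYPE('d) T) * measure (lam discr) (E \<inter> Bbox discr T)"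
proof -
  have "(\<lambda>t. indicat_real (Bbox discr T) t *\<^sub>R indicator E t) = indicat_real (E \<inter> Bbox discr T)"
    by (auto simp: indicator_def)
  moreover have "E \<inter> Bbox discr T \<inter> space (lam discr) = E \<inter> Bbox discr T" using Bbox_subset[of discr T] by auto
  ultimately show ?thesis by (simp add: avg_def set_lebesgue_integral_def)
qed

lemma avg_const_tendsto: "((\<lambda>T. avg discr T (\<lambda>t::real^'d. c)) \<longlongrightarrow> c) at_top"
proof -
  have "((\<lambda>T. c * ((1 / Cvol TYPE('d) T) * measure (lam discr) (Bbox discr T :: (real^'d) set))) \<longlongrightarrow> c * 1) at_top"
    by (intro tendsto_mult_left measure_Bbox_tendsto)
  moreover have "avg discr T (\<lambda>t::real^'d. c) = c * ((1 / Cvol TYPE('d) T) * measure (lam discr) (Bbox discr T :: (real^'d) set))" for T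
    using avg_cmult[of discr T c "indicator UNIV :: real^'d \<Rightarrow> real"]
      avg_indicator[of discr T "UNIV :: (real^'d) set"] by (simp add: indicator_def)
  ultimately show ?thesis by simp
qed

section \<open>Vanishing averages, signed and absolute\<close>

text \<open>\<open>mean_zero\<close> is the signed notion that matches ergodicity,
  \<open>cesaro_null\<close> the absolute one that matches weak mixing. The bound contained in both
  makes them stable under products and limits.\<close>

definition mean_zero :: "bool \<Rightarrow> (real^'d \<Rightarrow> real) \<Rightarrow> bool" where
  "mean_zero discr f \<longleftrightarrow> bdd_meas discr f \<and> ((\<lambda>T. avg discr T f) \<longlongrightarrow> 0) at_top"

definition cesaro_null :: "bool \<Rightarrow> (real^'d \<Rightarrow> real) \<Rightarrow> bool" where
  "cesaro_null discr f \<longleftrightarrow> bdd_meas discr f \<and> ((\<lambda>T. avg discr T (\<lambda>t. \<bar>f t\<bar>)) \<longlongrightarrow> 0) at_top"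

lemma mean_zero_add:
  assumes "mean_zero discr f" "mean_zero discr g" shows "mean_zero discr (\<lambda>t. f t + g t)"
proof -
  have "((\<lambda>T. avg discr T f + avg discr T g) \<longlongrightarrow> 0 + 0) at_top"
    using assms by (intro tendsto_add) (auto simp: mean_zero_def)
  moreover have "\<forall>\<^sub>F T in at_top. avg discr T f + avg discr T g = avg discr T (\<lambda>t. f t + g t)"
    by (rule eventually_mono[OF eventually_gt_at_top[of 0]]) (use assms in \<open>auto simp: mean_zero_def avg_add\<close>)
  ultimately have "((\<lambda>T. avg discr T (\<lambda>t. f t + g t)) \<longlongrightarrow> 0) at_top"
    by (auto elim: Lim_transform_eventually)
  then show ?thesis using assms by (auto simp: mean_zero_def bdd_meas_add)
qed

lemma mean_zero_cmult:
  assumes "mean_zero discr f" shows "mean_zero discr (\<lambda>t. c * f t)"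
  using assms tendsto_mult_right_zero[of "\<lambda>T. avg discr T f" at_top c]
  by (auto simp: mean_zero_def avg_cmult bdd_meas_mult)

text \<open>The average of the constant eps tends to eps, so a majorant up to every constant error
  suffices; nonnegativity takes care of the lower side.\<close>

lemma mean_zero_nonnegI:
  fixes f :: "real^'d \<Rightarrow> real"
  assumes f: "bdd_meas discr f" and nonneg: "\<And>t. t \<in> Tset discr \<Longrightarrow> 0 \<le> f t"
    and approx: "\<And>\<epsilon>. \<epsilon> > 0 \<Longrightarrow> \<exists>g. mean_zero discr g \<and> (\<forall>t\<in>Tset discr. f t \<le> \<epsilon> + g t)"
  shows "mean_zero discr f"
proof -
  have "((\<lambda>T. avg discr T f) \<longlongrightarrow> 0) at_top"
  proof (rule tendstoI)
    fix \<epsilon> :: real assume "\<epsilon> > 0"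
    then obtain g where g: "mean_zero discr g" "\<And>t. t \<in> Tset discr \<Longrightarrow> f t \<le> \<epsilon> / 2 + g t"
      using approx[of "\<epsilon> / 2"] by auto
    have "((\<lambda>T. avg discr T (\<lambda>t::real^'d. \<epsilon> / 2) + avg discr T g) \<longlongrightarrow> \<epsilon> / 2 + 0) at_top"
      using g by (intro tendsto_add avg_const_tendsto) (auto simp: mean_zero_def)
    then have "\<forall>\<^sub>F T in at_top. avg discr T (\<lambda>t::real^'d. \<epsilon> / 2) + avg discr T g < \<epsilon>"
      by (rule order_tendstoD(2)) (use \<open>\<epsilon> > 0\<close> in auto)
    then show "\<forall>\<^sub>F T in at_top. dist (avg discr T f) 0 < \<epsilon>"
      using eventually_gt_at_top[of 0]
    proof eventually_elim
      case (elim T)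
      have "avg discr T f \<le> avg discr T (\<lambda>t. \<epsilon> / 2 + g t)"
        using g f elim Bbox_subset[of discr T]
        by (intro avg_mono) (auto simp: mean_zero_def intro!: bdd_meas_add)
      also have "\<dots> = avg discr T (\<lambda>t::real^'d. \<epsilon> / 2) + avg discr T g"
        using g elim by (intro avg_add) (auto simp: mean_zero_def)
      finally have "avg discr T f < \<epsilon>" using elim by simp
      moreover have "avg discr T (\<lambda>t::real^'d. 0) \<le> avg discr T f"
        using f nonneg elim Bbox_subset[of discr T] by (intro avg_mono) auto
      moreover have "avg discr T (\<lambda>t::real^'d. 0) = 0"
        using avg_cmult[of discr T 0 "\<lambda>t::real^'d. 0"] by simp
      ultimately show ?case by (simp add: dist_real_def)
    qed
  qed
  with f show ?thesis by (simp add: mean_zero_def)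
qed

lemma cesaro_null_iff_mean_zero: "cesaro_null discr f \<longleftrightarrow> bdd_meas discr f \<and> mean_zero discr (\<lambda>t. \<bar>f t\<bar>)"
  by (auto simp: mean_zero_def cesaro_null_def bdd_meas_abs)

lemma cesaro_nullI:
  assumes "bdd_meas discr f"
    and "\<And>\<epsilon>. \<epsilon> > 0 \<Longrightarrow> \<exists>g. cesaro_null discr g \<and> (\<forall>t\<in>Tset discr. \<bar>f t\<bar> \<le> \<epsilon> + \<bar>g t\<bar>)"
  shows "cesaro_null discr f"
  using assms(1) mean_zero_nonnegI[OF bdd_meas_abs[OF assms(1)]] assms(2)
  unfolding cesaro_null_iff_mean_zero by (metis abs_ge_zero)

lemma cesaro_null_cmult:
  assumes "cesaro_null discr f" shows "cesaro_null discr (\<lambda>t. c * f t)"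
  using assms mean_zero_cmult[of discr "\<lambda>t. \<bar>f t\<bar>" "\<bar>c\<bar>"]
  by (auto simp: cesaro_null_iff_mean_zero abs_mult bdd_meas_mult)

lemma cesaro_null_add:
  assumes "cesaro_null discr f" "cesaro_null discr g" shows "cesaro_null discr (\<lambda>t. f t + g t)"
proof (rule cesaro_nullI)
  show "bdd_meas discr (\<lambda>t. f t + g t)" using assms by (auto simp: cesaro_null_def bdd_meas_add)
  fix \<epsilon> :: real assume "\<epsilon> > 0"
  have "cesaro_null discr (\<lambda>t. \<bar>f t\<bar> + \<bar>g t\<bar>)"
    using assms mean_zero_add[of discr "\<lambda>t. \<bar>f t\<bar>" "\<lambda>t. \<bar>g t\<bar>"]
    by (auto simp: cesaro_null_iff_mean_zero bdd_meas_add bdd_meas_abs)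
  moreover have "\<forall>t\<in>Tset discr. \<bar>f t + g t\<bar> \<le> \<epsilon> + \<bar>\<bar>f t\<bar> + \<bar>g t\<bar>\<bar>" using \<open>\<epsilon> > 0\<close> by auto
  ultimately show "\<exists>h. cesaro_null discr h \<and> (\<forall>t\<in>Tset discr. \<bar>f t + g t\<bar> \<le> \<epsilon> + \<bar>h t\<bar>)" by blast
qed

lemma cesaro_null_0: "cesaro_null discr (\<lambda>t. 0)"
  using avg_const_tendsto[of discr 0] by (simp add: cesaro_null_def)

lemma cesaro_null_sum:
  "finite I \<Longrightarrow> (\<And>i. i \<in> I \<Longrightarrow> cesaro_null discr (f i)) \<Longrightarrow> cesaro_null discr (\<lambda>t. \<Sum>i\<in>I. f i t)"
  by (induction I rule: finite_induct) (auto intro: cesaro_null_0 cesaro_null_add)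

lemma cesaro_null_abs: "cesaro_null discr f \<Longrightarrow> cesaro_null discr (\<lambda>t. \<bar>f t\<bar>)"
  by (auto simp: cesaro_null_def bdd_meas_abs)

text \<open>The inequality \<open>\<bar>x\<bar> \<le> \<epsilon> + x\<^sup>2 / \<epsilon>\<close>
  takes the place of Cauchy-Schwarz and avoids any square root of averages.\<close>

lemma cesaro_null_of_square:
  assumes "bdd_meas discr f" "mean_zero discr (\<lambda>t. (f t)\<^sup>2)"
  shows "cesaro_null discr f"
proof (rule cesaro_nullI[OF assms(1)])
  fix \<epsilon> :: real assume e: "\<epsilon> > 0"
  have "cesaro_null discr (\<lambda>t. (f t)\<^sup>2)" using assms(2) by (simp add: cesaro_null_iff_mean_zero mean_zero_def)
  then have "cesaro_null discr (\<lambda>t. (1 / \<epsilon>) * (f t)\<^sup>2)" by (rule cesaro_null_cmult)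
  moreover have "\<bar>f t\<bar> \<le> \<epsilon> + \<bar>(1 / \<epsilon>) * (f t)\<^sup>2\<bar>" for t
  proof (cases "\<bar>f t\<bar> \<le> \<epsilon>")
    case False
    then have "\<epsilon> * \<bar>f t\<bar> \<le> \<bar>f t\<bar> * \<bar>f t\<bar>" by (intro mult_right_mono) auto
    then have "\<bar>f t\<bar> \<le> (1 / \<epsilon>) * (f t)\<^sup>2" using e by (simp add: field_simps power2_eq_square)
    then show ?thesis using e by linarith
  qed (use e in \<open>auto intro: add_increasing2\<close>)
  ultimately show "\<exists>g. cesaro_null discr g \<and> (\<forall>t\<in>Tset discr. \<bar>f t\<bar> \<le> \<epsilon> + \<bar>g t\<bar>)" by blast
qed

lemma cesaro_null_uniform_limit:
  assumes "bdd_meas discr f"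
    and "\<And>\<epsilon>. \<epsilon> > 0 \<Longrightarrow> \<exists>g. cesaro_null discr g \<and> (\<forall>t\<in>Tset discr. \<bar>f t - g t\<bar> \<le> \<epsilon>)"
  shows "cesaro_null discr f"
proof (rule cesaro_nullI[OF assms(1)])
  fix \<epsilon> :: real assume "\<epsilon> > 0"
  then obtain g where "cesaro_null discr g" "\<And>t. t \<in> Tset discr \<Longrightarrow> \<bar>f t - g t\<bar> \<le> \<epsilon>" using assms(2) by blast
  then show "\<exists>g. cesaro_null discr g \<and> (\<forall>t\<in>Tset discr. \<bar>f t\<bar> \<le> \<epsilon> + \<bar>g t\<bar>)"
    by (intro exI[of _ g]) (fastforce simp: abs_le_iff)
qed

lemma cesaro_null_imp_mean_zero:
  assumes "cesaro_null discr f" shows "mean_zero discr f"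
proof -
  have f: "bdd_meas discr f" using assms by (simp add: cesaro_null_def)
  have "((\<lambda>T. avg discr T f) \<longlongrightarrow> 0) at_top"
  proof (rule Lim_null_comparison)
    show "\<forall>\<^sub>F T in at_top. norm (avg discr T f) \<le> avg discr T (\<lambda>t. \<bar>f t\<bar>)"
      using eventually_gt_at_top[of 0]
    proof eventually_elim
      case (elim T)
      have "avg discr T f \<le> avg discr T (\<lambda>t. \<bar>f t\<bar>)"
        using f elim by (intro avg_mono bdd_meas_abs) auto
      moreover have "avg discr T (\<lambda>t. (-1) * f t) \<le> avg discr T (\<lambda>t. \<bar>f t\<bar>)"
        using f elim by (intro avg_mono bdd_meas_abs bdd_meas_mult) auto
      ultimately show ?case using avg_cmult[of discr T "-1" f] by (simp add: abs_le_iff)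
    qed
  qed (use assms in \<open>simp add: cesaro_null_def\<close>)
  with f show ?thesis by (simp add: mean_zero_def)
qed

lemma mean_zero_uniform_limit:
  fixes f :: "real^'d \<Rightarrow> real"
  assumes "bdd_meas discr f"
    and "\<And>\<epsilon>. \<epsilon> > 0 \<Longrightarrow> \<exists>g. mean_zero discr g \<and> (\<forall>t\<in>Tset discr. \<bar>f t - g t\<bar> \<le> \<epsilon>)"
  shows "mean_zero discr f"
proof -
  have "((\<lambda>T. avg discr T f) \<longlongrightarrow> 0) at_top"
  proof (rule tendstoI)
    fix \<epsilon> :: real assume e: "\<epsilon> > 0"
    then obtain g where g: "mean_zero discr g" "\<And>t. t \<in> Tset discr \<Longrightarrow> \<bar>f t - g t\<bar> \<le> \<epsilon> / 3"
      using assms(2)[of "\<epsilon> / 3"] by auto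
    have gb: "bdd_meas discr g" and lim: "((\<lambda>T. avg discr T g) \<longlongrightarrow> 0) at_top"
      using g by (auto simp: mean_zero_def)
    \<comment> \<open>On the lattice the average of a constant can exceed that constant at finite
      \<open>T\<close>; the bound \<open>2 * \<epsilon> / 3\<close> leaves room for this.\<close>
    have "\<forall>\<^sub>F T in at_top. avg discr T (\<lambda>t::real^'d. \<epsilon> / 3) < 2 * \<epsilon> / 3"
      using e by (intro order_tendstoD(2)[OF avg_const_tendsto]) auto
    moreover have "\<forall>\<^sub>F T in at_top. \<bar>avg discr T g\<bar> < \<epsilon> / 3"
      using tendstoD[OF lim, of "\<epsilon> / 3"] e by (simp add: dist_real_def)
    ultimately show "\<forall>\<^sub>F T in at_top. dist (avg discr T f) 0 < \<epsilon>"
      using eventually_gt_at_top[of 0]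
    proof eventually_elim
      case (elim T)
      have *: "f t \<le> \<epsilon> / 3 + g t \<and> g t \<le> \<epsilon> / 3 + f t" if "t \<in> Bbox discr T" for t
        using g(2)[OF subsetD[OF Bbox_subset that]] unfolding abs_le_iff by linarith
      have "avg discr T f \<le> avg discr T (\<lambda>t. \<epsilon> / 3 + g t)"
        using gb assms(1) elim * by (intro avg_mono bdd_meas_add) auto
      moreover have "avg discr T g \<le> avg discr T (\<lambda>t. \<epsilon> / 3 + f t)"
        using gb assms(1) elim * by (intro avg_mono bdd_meas_add) auto
      ultimately show ?case
        using elim avg_add[OF bdd_meas_const gb, of T "\<epsilon> / 3"] avg_add[OF bdd_meas_const assms(1), of T "\<epsilon> / 3"]
        by (auto simp: dist_real_def abs_less_iff)
    qed
  qed
  with assms(1) show ?thesis by (simp add: mean_zero_def)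
qed

section \<open>Koopman-von Neumann: absolute averages and density-one sets\<close>

lemma density_zero_iff_cesaro_null:
  assumes "E \<in> sets (lam discr)"
  shows "density_zero discr E \<longleftrightarrow> cesaro_null discr (indicator E)"
  using assms bdd_meas_indicator[OF assms] avg_indicator[of discr _ E]
  by (simp add: density_zero_def cesaro_null_def)

lemma maxnorm_le_Bbox: "t \<in> Bbox discr T \<Longrightarrow> maxnorm t \<le> T"
  unfolding maxnorm_def Bbox_def by (auto simp: abs_le_iff intro: less_imp_le minus_le_iff[THEN iffD2])

lemma borel_measurable_maxnorm [measurable]: "(maxnorm :: real^'d \<Rightarrow> real) \<in> borel_measurable (lam discr)"
proof -
  have "(\<lambda>t::real^'d. Max ((\<lambda>i. \<bar>t$i\<bar>) ` UNIV)) \<in> borel_measurable borel"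
    by (intro borel_measurable_Max) auto
  then have "(maxnorm :: real^'d \<Rightarrow> real) \<in> borel_measurable borel" by (simp add: maxnorm_def[abs_def])
  then show ?thesis by (auto simp: lam_def intro: measurable_completion)
qed

text \<open>The exceptional set is where \<open>\<bar>f t\<bar> \<ge> sqrt (b (maxnorm t))\<close> for a decreasing majorant \<open>b\<close> of the
  averages of \<open>\<bar>f\<bar>\<close>; Markov's inequality on the box of size \<open>T\<close> bounds its density there by \<open>sqrt (b T)\<close>.\<close>
lemma cesaro_null_imp_vanishes_on_density_one:
  fixes f :: "real^'d \<Rightarrow> real"
  assumes "cesaro_null discr f"
  shows "\<exists>D. density_one discr D \<and> (\<forall>\<epsilon>>0. \<exists>R. \<forall>t\<in>D. R \<le> maxnorm t \<longrightarrow> \<bar>f t\<bar> < \<epsilon>)"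
proof -
  have f: "bdd_meas discr f" using assms by (simp add: cesaro_null_def)
  define a where "a T = avg discr T (\<lambda>t. \<bar>f t\<bar>)" for T
  have a_lim: "(a \<longlongrightarrow> 0) at_top" using assms by (simp add: cesaro_null_def a_def[abs_def])
  have a_nonneg: "0 \<le> a T" if "T > 0" for T
    using avg_mono[OF bdd_meas_const[of discr 0] bdd_meas_abs[OF f] that]
      avg_cmult[of discr T 0 "\<lambda>t::real^'d. 0"] by (simp add: a_def)
  have "\<forall>\<^sub>F T in at_top. a T < 1" using a_lim by (rule order_tendstoD) simp
  then obtain T1 where T1: "\<And>T. T \<ge> T1 \<Longrightarrow> a T < 1" by (auto simp: eventually_at_top_linorder)
  \<comment> \<open>From \<open>T0\<close> on the averages are below 1, so the supremum defining
    \<open>s\<close> is over a bounded set; \<open>T0\<close> is at least 1 so that only boxes of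
    positive size occur.\<close>
  define T0 where "T0 = max T1 1"
  define s where "s T = (SUP S\<in>{max T T0..}. a S)" for T
  have bdd: "bdd_above (a ` {max T T0..})" for T
    using T1 by (intro bdd_aboveI[of _ 1]) (auto simp: T0_def intro: less_imp_le)
  have a_le_s: "a T \<le> s T" if "T \<ge> T0" for T
    unfolding s_def using that by (intro cSUP_upper bdd) auto
  have s_anti: "s T' \<le> s T" if "T \<le> T'" for T T'
    unfolding s_def using that by (intro cSUP_subset_mono bdd) auto
  have s_nonneg: "0 \<le> s T" for T
  proof -
    have "0 \<le> a (max T T0)" by (intro a_nonneg) (auto simp: T0_def)
    also have "\<dots> \<le> s T" unfolding s_def by (intro cSUP_upper bdd) auto
    finally show ?thesis .
  qed
  \<comment> \<open>The square root is already part of this \<open>b\<close>. The term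
    \<open>exp (- T)\<close> keeps \<open>b\<close> strictly positive even if the averages vanish,
    so that division by \<open>b T\<close> is possible.\<close>
  define b where "b T = sqrt (s T + exp (- T))" for T
  have b_pos: "b T > 0" for T unfolding b_def using s_nonneg[of T] by (simp add: add_nonneg_pos)
  have b_anti: "b T' \<le> b T" if "T \<le> T'" for T T'
    unfolding b_def using that s_anti by (simp add: add_mono)
  have s_lim: "(s \<longlongrightarrow> 0) at_top"
  proof (rule tendstoI)
    fix \<epsilon> :: real assume "\<epsilon> > 0"
    then have "\<forall>\<^sub>F T in at_top. a T < \<epsilon> / 2" using a_lim by (intro order_tendstoD) auto
    then obtain T2 where T2: "\<And>T. T \<ge> T2 \<Longrightarrow> a T < \<epsilon> / 2" by (auto simp: eventually_at_top_linorder)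
    have "s T \<le> \<epsilon> / 2" if "T \<ge> T2" for T
      unfolding s_def using T2 that by (intro cSUP_least) (auto intro: less_imp_le)
    then show "\<forall>\<^sub>F T in at_top. dist (s T) 0 < \<epsilon>"
      using s_nonneg \<open>\<epsilon> > 0\<close> unfolding eventually_at_top_linorder
      by (intro exI[of _ T2]) (fastforce simp: dist_real_def)
  qed
  have "((\<lambda>T. exp (- T)) \<longlongrightarrow> (0::real)) at_top"
    by (intro filterlim_compose[OF exp_at_bot] filterlim_uminus_at_bot_at_top)
  from tendsto_real_sqrt[OF tendsto_add[OF s_lim this]]
  have b_lim: "(b \<longlongrightarrow> 0) at_top" by (simp add: b_def[abs_def])
  \<comment> \<open>Monotonicity of \<open>b\<close> is what makes the level set \<open>E\<close>
    below measurable.\<close>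
  have "mono (\<lambda>T. - b T)" using b_anti by (auto simp: mono_def)
  then have "(\<lambda>T. - (- b T)) \<in> borel_measurable borel"
    by (intro borel_measurable_uminus borel_measurable_mono)
  then have [measurable]: "b \<in> borel_measurable borel" by simp
  have [measurable]: "f \<in> borel_measurable (lam discr)" using f by (rule bdd_measD)
  define E where "E = {t \<in> space (lam discr). b (maxnorm t) \<le> \<bar>f t\<bar>}"
  have E: "E \<in> sets (lam discr)" unfolding E_def by measurable
  have "((\<lambda>T. avg discr T (indicator E)) \<longlongrightarrow> 0) at_top"
  proof (rule Lim_null_comparison[OF _ b_lim])
    show "\<forall>\<^sub>F T in at_top. norm (avg discr T (indicator E)) \<le> b T"
      using eventually_ge_at_top[of T0]
    proof eventually_elim
      case (elim T)
      then have T: "T > 0" by (simp add: T0_def)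
      have "avg discr T (indicator E) \<le> avg discr T (\<lambda>t. (1 / b T) * \<bar>f t\<bar>)"
      proof (rule avg_mono)
        fix t :: "real^'d" assume t: "t \<in> Bbox discr T"
        show "indicator E t \<le> (1 / b T) * \<bar>f t\<bar>"
        proof (cases "t \<in> E")
          case True
          then have "b T \<le> \<bar>f t\<bar>" using b_anti[OF maxnorm_le_Bbox[OF t]] by (auto simp: E_def)
          with True b_pos[of T] show ?thesis by (simp add: field_simps)
        next
          case False
          with b_pos[of T] show ?thesis by (simp add: less_imp_le)
        qed
      qed (intro bdd_meas_indicator bdd_meas_mult bdd_meas_abs bdd_meas_const T f E)+
      also have "\<dots> = a T / b T" by (subst avg_cmult) (simp add: a_def)
      also have "\<dots> \<le> (b T)\<^sup>2 / b T"
        using a_le_s[OF elim] s_nonneg[of T] b_pos[of T]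
        by (intro divide_right_mono) (auto simp: b_def intro: add_increasing2)
      also have "\<dots> = b T" using b_pos[of T] by (simp add: power2_eq_square)
      finally have "avg discr T (indicator E) \<le> b T" .
      moreover have "0 \<le> avg discr T (indicator E)"
        using Cvol_pos[OF T, where ?'d='d] by (simp add: avg_indicator)
      ultimately show ?case by simp
    qed
  qed
  then have "density_zero discr E"
    using bdd_meas_indicator[OF E] by (simp add: density_zero_iff_cesaro_null[OF E] cesaro_null_def)
  moreover have "Tset discr - (Tset discr - E) = E" by (auto simp: E_def)
  ultimately have "density_one discr (Tset discr - E)" by (simp add: density_one_def)
  moreover have "\<exists>R. \<forall>t\<in>Tset discr - E. R \<le> maxnorm t \<longrightarrow> \<bar>f t\<bar> < \<epsilon>" if "\<epsilon> > 0" for \<epsilon>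
  proof -
    have "\<forall>\<^sub>F T in at_top. b T < \<epsilon>" using b_lim that by (rule order_tendstoD)
    then obtain R where "\<And>T. T \<ge> R \<Longrightarrow> b T < \<epsilon>" by (auto simp: eventually_at_top_linorder)
    then show ?thesis by (intro exI[of _ R]) (fastforce simp: E_def)
  qed
  ultimately show ?thesis by blast
qed

text \<open>The weighted sum \<open>F\<close> of all \<open>\<bar>f k\<bar>\<close> with weights
  \<open>(1/2)^k\<close> again has vanishing averages and dominates each weighted term. The one
  density-one set belonging to \<open>F\<close> therefore serves every \<open>k\<close>, with no
  diagonal construction of sets.\<close>

lemma cesaro_null_family_vanishes_on_density_one:
  fixes f :: "nat \<Rightarrow> real^'d \<Rightarrow> real"
  assumes null: "\<And>k. cesaro_null discr (f k)" and le1: "\<And>k t. t \<in> Tset discr \<Longrightarrow> \<bar>f k t\<bar> \<le> 1"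
  shows "\<exists>D. density_one discr D \<and> (\<forall>k. \<forall>\<epsilon>>0. \<exists>R. \<forall>t\<in>D. R \<le> maxnorm t \<longrightarrow> \<bar>f k t\<bar> < \<epsilon>)"
proof -
  define g where "g k t = (1/2)^k * \<bar>f k t\<bar>" for k t
  define F where "F t = (\<Sum>k. g k t)" for t
  have g_null: "cesaro_null discr (g k)" for k
    unfolding g_def by (intro cesaro_null_cmult cesaro_null_abs null)
  have g_nonneg: "0 \<le> g k t" for k t by (simp add: g_def)
  have g_le: "g k t \<le> (1/2)^k" if "t \<in> Tset discr" for k t
    using mult_left_mono[OF le1[OF that, of k], of "(1/2)^k"] by (simp add: g_def)
  have summ: "summable (\<lambda>k. g k t)" if "t \<in> Tset discr" for t
    by (rule summable_comparison_test[OF _ summable_geometric[of "1/2"]]) (use g_le[OF that] g_nonneg in auto)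
  have F_nonneg: "0 \<le> F t" if "t \<in> Tset discr" for t
    unfolding F_def using summ[OF that] g_nonneg by (intro suminf_nonneg) auto
  \<comment> \<open>\<open>n = 0\<close> yields the bound 2 for \<open>F\<close>; a large
    \<open>n\<close> reduces \<open>F\<close> to a finite sum up to a uniformly small error.\<close>
  have tail: "F t \<le> 2 * (1/2)^n + (\<Sum>k<n. g k t)" if t: "t \<in> Tset discr" for t n
  proof -
    have "F t = (\<Sum>k. g (k + n) t) + (\<Sum>k<n. g k t)"
      unfolding F_def by (rule suminf_split_initial_segment[OF summ[OF t]])
    moreover have "(\<Sum>k. g (k + n) t) \<le> (\<Sum>k. (1/2)^n * (1/2)^k)"
    proof (intro suminf_le summable_mult summable_geometric)
      show "g (k + n) t \<le> (1/2)^n * (1/2)^k" for k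
        using g_le[OF t, of "k + n"] by (simp only: power_add mult.commute)
      show "summable (\<lambda>k. g (k + n) t)" using summ[OF t] by (subst summable_iff_shift)
    qed auto
    moreover have "(\<Sum>k. (1/2)^n * (1/2)^k) = 2 * (1/2::real)^n"
      by (subst suminf_mult) (auto simp: suminf_geometric intro: summable_geometric)
    ultimately show ?thesis by simp
  qed
  have "bdd_meas discr F" unfolding bdd_meas_def
  proof (intro conjI exI[of _ 2] ballI)
    show "F \<in> borel_measurable (lam discr)" unfolding F_def
      using g_null by (intro borel_measurable_suminf) (auto simp: cesaro_null_def bdd_meas_def)
    show "\<bar>F t\<bar> \<le> 2" if "t \<in> Tset discr" for t using tail[OF that, of 0] F_nonneg[OF that] by simp
  qed
  then have "cesaro_null discr F"
  proof (rule cesaro_nullI)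
    fix \<epsilon> :: real assume "\<epsilon> > 0"
    then obtain n where n: "(1/2)^n < \<epsilon> / 2" using real_arch_pow_inv[of "\<epsilon>/2" "1/2"] by auto
    have "\<bar>F t\<bar> \<le> \<epsilon> + \<bar>\<Sum>k<n. g k t\<bar>" if "t \<in> Tset discr" for t
      using tail[OF that, of n] F_nonneg[OF that] n abs_ge_self[of "\<Sum>k<n. g k t"] by linarith
    then show "\<exists>h. cesaro_null discr h \<and> (\<forall>t\<in>Tset discr. \<bar>F t\<bar> \<le> \<epsilon> + \<bar>h t\<bar>)"
      using g_null by (intro exI[of _ "\<lambda>t. \<Sum>k<n. g k t"] conjI cesaro_null_sum) auto
  qed
  then obtain D where D: "density_one discr D"
    and lim: "\<And>\<epsilon>. \<epsilon> > 0 \<Longrightarrow> \<exists>R. \<forall>t\<in>D. R \<le> maxnorm t \<longrightarrow> \<bar>F t\<bar> < \<epsilon>"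
    using cesaro_null_imp_vanishes_on_density_one by blast
  have "\<exists>R. \<forall>t\<in>D. R \<le> maxnorm t \<longrightarrow> \<bar>f k t\<bar> < \<epsilon>" if e: "\<epsilon> > 0" for k \<epsilon>
  proof -
    obtain R where R: "\<And>t. t \<in> D \<Longrightarrow> R \<le> maxnorm t \<Longrightarrow> \<bar>F t\<bar> < (1/2)^k * \<epsilon>"
      using lim[of "(1/2)^k * \<epsilon>"] e by auto
    have "\<bar>f k t\<bar> < \<epsilon>" if t: "t \<in> D" "R \<le> maxnorm t" for t
    proof -
      have "t \<in> Tset discr" using D t by (auto simp: density_one_def)
      then have "g k t \<le> F t"
        unfolding F_def using sum_le_suminf[OF summ, of t "{k}"] g_nonneg by auto
      then have "(1/2)^k * \<bar>f k t\<bar> < (1/2)^k * \<epsilon>" using R[OF t] unfolding g_def by linarith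
      then show ?thesis by (rule mult_left_less_imp_less) simp
    qed
    then show ?thesis by blast
  qed
  with D show ?thesis by blast
qed

text \<open>Where \<open>f\<close> is not small, \<open>t\<close> lies outside \<open>D\<close> or
  in a fixed box; both sets have density zero, and \<open>f\<close> is bounded there by
  \<open>K\<close>.\<close>

lemma cesaro_null_if_vanishes_on_density_one:
  fixes f :: "real^'d \<Rightarrow> real"
  assumes f: "bdd_meas discr f" and D: "density_one discr D"
    and lim: "\<And>\<epsilon>. \<epsilon> > 0 \<Longrightarrow> \<exists>R. \<forall>t\<in>D. R \<le> maxnorm t \<longrightarrow> \<bar>f t\<bar> < \<epsilon>"
  shows "cesaro_null discr f"
proof (rule cesaro_nullI[OF f])
  fix \<epsilon> :: real assume "\<epsilon> > 0"
  then obtain R where R: "\<And>t. t \<in> D \<Longrightarrow> R \<le> maxnorm t \<Longrightarrow> \<bar>f t\<bar> < \<epsilon>" using lim by blast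
  obtain K where K: "\<And>t. t \<in> Tset discr \<Longrightarrow> \<bar>f t\<bar> \<le> K" using f by (auto simp: bdd_meas_def)
  define S where "S = max R 0 + 1"
  let ?E = "Tset discr - D" and ?B = "Bbox discr S :: (real^'d) set"
  have E: "cesaro_null discr (indicator ?E)"
    using D density_zero_iff_cesaro_null[of ?E discr] by (auto simp: density_one_def density_zero_def)
  have B: "cesaro_null discr (indicator ?B)"
  proof -
    have "((\<lambda>T. (1 / Cvol TYPE('d) T) * measure (lam discr) ?B) \<longlongrightarrow> 0) at_top"
    proof (intro tendsto_mult_left_zero tendsto_divide_0[OF tendsto_const] filterlim_at_top_imp_at_infinity)
      show "filterlim (Cvol TYPE('d)) at_top at_top"
        unfolding Cvol_def by (intro filterlim_pow_at_top filterlim_tendsto_pos_mult_at_top[OF tendsto_const] filterlim_ident) auto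
    qed
    moreover have "\<forall>\<^sub>F T in at_top. (1 / Cvol TYPE('d) T) * measure (lam discr) ?B = avg discr T (indicator ?B)"
      using eventually_ge_at_top[of S]
      by eventually_elim (simp add: avg_indicator Int_absorb2[OF Bbox_mono])
    ultimately have "((\<lambda>T. avg discr T (indicator ?B)) \<longlongrightarrow> 0) at_top"
      by (auto elim: Lim_transform_eventually)
    then show ?thesis by (simp add: cesaro_null_def bdd_meas_indicator)
  qed
  have "\<bar>f t\<bar> \<le> \<epsilon> + \<bar>K * (indicator ?E t + indicator ?B t)\<bar>" if t: "t \<in> Tset discr" for t
  proof (cases "t \<in> D \<and> R \<le> maxnorm t")
    case True
    then have "\<bar>f t\<bar> < \<epsilon>" using R[of t] by auto
    then show ?thesis by linarith
  next
    case False
    have "t \<in> ?B" if "maxnorm t < R"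
    proof -
      have "- S < t$i \<and> t$i \<le> S" for i
      proof -
        have "\<bar>t$i\<bar> < R" using that unfolding maxnorm_def by (subst (asm) Max_less_iff) auto
        then show ?thesis unfolding S_def by linarith
      qed
      then show ?thesis using t by (simp add: Bbox_def)
    qed
    with False t have "1 \<le> indicat_real ?E t + indicat_real ?B t" by (auto simp: indicator_def)
    then have "\<bar>K\<bar> * 1 \<le> \<bar>K\<bar> * (indicator ?E t + indicator ?B t)" by (intro mult_left_mono) auto
    with K[OF t] \<open>\<epsilon> > 0\<close> show ?thesis by (simp add: abs_mult)
  qed
  moreover have "cesaro_null discr (\<lambda>t. K * (indicator ?E t + indicator ?B t))"
    by (intro cesaro_null_cmult cesaro_null_add E B)
  ultimately show "\<exists>g. cesaro_null discr g \<and> (\<forall>t\<in>Tset discr. \<bar>f t\<bar> \<le> \<epsilon> + \<bar>g t\<bar>)" by blast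
qed

section \<open>Separability of countably generated \<open>\<sigma>\<close>-algebras\<close>

lemma sets_pair_sigma_mono:
  assumes "C \<subseteq> C'" "C' \<subseteq> sets M"
  shows "sets (N \<Otimes>\<^sub>M sigma (space M) C) \<subseteq> sets (N \<Otimes>\<^sub>M sigma (space M) C')"
proof -
  have "C' \<subseteq> Pow (space M)" "C \<subseteq> Pow (space M)" using assms sets.space_closed[of M] by auto
  then have "sets (sigma (space M) C) \<subseteq> sets (sigma (space M) C')"
    using assms by (simp add: sigma_sets_mono')
  then show ?thesis
    unfolding sets_pair_measure space_measure_of_conv by (intro sigma_sets_mono') blast
qed

text \<open>A rectangle needs one set of the second factor, and the property passes to complements
  and countable unions, a countable union of countable families being countable.\<close>

lemma pair_measure_set_countably_generated:
  assumes "E \<in> sets (N \<Otimes>\<^sub>M M)"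
  shows "\<exists>C. countable C \<and> C \<subseteq> sets M \<and> E \<in> sets (N \<Otimes>\<^sub>M sigma (space M) C)"
proof -
  have "E \<in> sigma_sets (space N \<times> space M) {a \<times> b | a b. a \<in> sets N \<and> b \<in> sets M}"
    using assms by (simp add: sets_pair_measure)
  then show ?thesis
  proof (induction rule: sigma_sets.induct)
    case (Basic E)
    then obtain a b where ab: "E = a \<times> b" "a \<in> sets N" "b \<in> sets M" by auto
    then have "b \<in> sets (sigma (space M) {b})" using sets.sets_into_space[of b M] by auto
    with ab show ?case by (intro exI[of _ "{b}"]) auto
  next
    case Empty
    show ?case by (intro exI[of _ "{}"]) auto
  next
    case (Compl E)
    then obtain C where C: "countable C" "C \<subseteq> sets M" "E \<in> sets (N \<Otimes>\<^sub>M sigma (space M) C)" by blast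
    then have "space (N \<Otimes>\<^sub>M sigma (space M) C) - E \<in> sets (N \<Otimes>\<^sub>M sigma (space M) C)" by blast
    with C show ?case by (auto simp: space_pair_measure space_measure_of_conv)
  next
    case (Union E)
    then have "\<forall>i. \<exists>C. countable C \<and> C \<subseteq> sets M \<and> E i \<in> sets (N \<Otimes>\<^sub>M sigma (space M) C)" by blast
    then obtain C where C: "\<And>i. countable (C i)" "\<And>i. C i \<subseteq> sets M"
      "\<And>i. E i \<in> sets (N \<Otimes>\<^sub>M sigma (space M) (C i))"
      by metis
    have sub: "(\<Union>i. C i) \<subseteq> sets M" using C(2) by blast
    have "E i \<in> sets (N \<Otimes>\<^sub>M sigma (space M) (\<Union>i. C i))" for i
      using C(3)[of i] sets_pair_sigma_mono[OF UN_upper[OF UNIV_I, of C i] sub, of N] by blast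
    then have "(\<Union>i. E i) \<in> sets (N \<Otimes>\<^sub>M sigma (space M) (\<Union>i. C i))"
      by (intro sets.countable_UN) blast
    with sub C(1) show ?case by (intro exI[of _ "\<Union>i. C i"]) simp
  qed
qed

text \<open>Preimages of a countable basis determine measurability. The gain is that all sections of
  \<open>f\<close>, possibly uncountably many, become measurable for one countably generated
  sigma-algebra.\<close>

lemma pair_measurable_countably_generated:
  fixes f :: "'a \<times> 'b \<Rightarrow> real"
  assumes "f \<in> borel_measurable (N \<Otimes>\<^sub>M M)"
  shows "\<exists>C. countable C \<and> C \<subseteq> sets M \<and> f \<in> borel_measurable (N \<Otimes>\<^sub>M sigma (space M) C)"
proof -
  obtain B :: "real set set" where B: "countable B" "topological_basis B"
    using ex_countable_basis by blast
  have "\<exists>C. countable C \<and> C \<subseteq> sets M \<and> f -` U \<inter> space (N \<Otimes>\<^sub>M M) \<in> sets (N \<Otimes>\<^sub>M sigma (space M) C)"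
    if "U \<in> B" for U
    using topological_basis_open[OF B(2) that]
    by (intro pair_measure_set_countably_generated measurable_sets[OF assms]) simp
  then obtain C where C: "\<And>U. U \<in> B \<Longrightarrow> countable (C U)" "\<And>U. U \<in> B \<Longrightarrow> C U \<subseteq> sets M"
    "\<And>U. U \<in> B \<Longrightarrow> f -` U \<inter> space (N \<Otimes>\<^sub>M M) \<in> sets (N \<Otimes>\<^sub>M sigma (space M) (C U))"
    by metis
  define C' where "C' = (\<Union>U\<in>B. C U)"
  have C': "countable C'" "C' \<subseteq> sets M" using C B by (auto simp: C'_def)
  have sp: "space (N \<Otimes>\<^sub>M sigma (space M) C') = space (N \<Otimes>\<^sub>M M)"
    by (simp add: space_pair_measure space_measure_of_conv)
  have "f \<in> measurable (N \<Otimes>\<^sub>M sigma (space M) C') (sigma UNIV B)"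
  proof (rule measurable_measure_of)
    fix U assume U: "U \<in> B"
    then have "C U \<subseteq> C'" by (auto simp: C'_def)
    then show "f -` U \<inter> space (N \<Otimes>\<^sub>M sigma (space M) C') \<in> sets (N \<Otimes>\<^sub>M sigma (space M) C')"
      unfolding sp using C(3)[OF U] sets_pair_sigma_mono[OF _ C'(2), of "C U" N] by blast
  qed auto
  then show ?thesis using C' B borel_eq_countable_basis[OF B] by auto
qed

text \<open>The closure operations are applied in countably many rounds, each of which keeps the
  family countable.\<close>

lemma countable_algebra_generated:
  assumes "countable C"
  shows "\<exists>D. countable D \<and> C \<subseteq> D \<and> {} \<in> D \<and> (\<forall>A\<in>D. \<Omega> - A \<in> D) \<and> (\<forall>A\<in>D. \<forall>B\<in>D. A \<union> B \<in> D) \<and>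
    D \<subseteq> sigma_sets \<Omega> C"
proof -
  define step where "step S = insert {} S \<union> (\<lambda>A. \<Omega> - A) ` S \<union> (\<lambda>(A, B). A \<union> B) ` (S \<times> S)" for S :: "'a set set"
  define D where "D n = (step ^^ n) C" for n
  have D_Suc: "D (Suc n) = step (D n)" for n by (simp add: D_def)
  have ctb: "countable (D n)" for n
    by (induction n) (use assms in \<open>auto simp: D_def step_def\<close>)
  have sub: "D n \<subseteq> D (Suc n)" for n unfolding D_Suc by (auto simp: step_def)
  have mono: "D m \<subseteq> D n" if "m \<le> n" for m n using sub that by (rule lift_Suc_mono_le)
  have sig: "D n \<subseteq> sigma_sets \<Omega> C" for n
  proof (induction n)
    case 0
    show ?case by (auto simp: D_def)
  next
    case (Suc n)
    then show ?case unfolding D_Suc step_def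
      by (auto intro: sigma_sets.Empty sigma_sets.Compl sigma_sets_Un)
  qed
  have base: "{} \<in> D (Suc 0)" "C \<subseteq> D 0" by (auto simp: D_def step_def)
  have compl: "\<Omega> - A \<in> D (Suc n)" if "A \<in> D n" for A n
    using that unfolding D_Suc step_def by auto
  have un: "\<exists>k. A \<union> B \<in> D k" if "A \<in> D m" "B \<in> D n" for A B m n
  proof -
    have "A \<in> D (max m n)" "B \<in> D (max m n)" using that mono[of m "max m n"] mono[of n "max m n"] by auto
    then have "A \<union> B \<in> D (Suc (max m n))" unfolding D_Suc step_def by auto
    then show ?thesis by blast
  qed
  show ?thesis
  proof (intro exI[of _ "\<Union>n. D n"] conjI ballI)
    show "countable (\<Union>n. D n)" using ctb by simp
    show "C \<subseteq> (\<Union>n. D n)" "{} \<in> (\<Union>n. D n)" using base by blast+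
    show "(\<Union>n. D n) \<subseteq> sigma_sets \<Omega> C" using sig by blast
    show "\<Omega> - A \<in> (\<Union>n. D n)" if "A \<in> (\<Union>n. D n)" for A using compl that by blast
    show "A \<union> B \<in> (\<Union>n. D n)" if "A \<in> (\<Union>n. D n)" "B \<in> (\<Union>n. D n)" for A B
    proof -
      obtain m n where "A \<in> D m" "B \<in> D n" using \<open>A \<in> _\<close> \<open>B \<in> _\<close> by (elim UN_E)
      from un[OF this] show ?thesis by (elim exE) (rule UN_I[OF UNIV_I])
    qed
  qed
qed

lemma (in finite_measure) measure_sym_diff_triangle:
  assumes "A \<in> sets M" "B \<in> sets M" "C \<in> sets M"
  shows "measure M ((A - C) \<union> (C - A)) \<le> measure M ((A - B) \<union> (B - A)) + measure M ((B - C) \<union> (C - B))"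
proof -
  have "measure M ((A - C) \<union> (C - A)) \<le> measure M (((A - B) \<union> (B - A)) \<union> ((B - C) \<union> (C - B)))"
    using assms by (intro finite_measure_mono) auto
  also have "\<dots> \<le> measure M ((A - B) \<union> (B - A)) + measure M ((B - C) \<union> (C - B))"
    using assms by (intro measure_Un_le) auto
  finally show ?thesis .
qed

text \<open>Symmetric differences are unchanged by complementation, and a countable union is within
  \<open>\<epsilon> / 2\<close> of a finite one by continuity from below; finite unions are
  approximated term by term inside the algebra.\<close>

lemma (in finite_measure) sigma_sets_approx_by_algebra:
  assumes C: "C \<subseteq> D" "D \<subseteq> sets M" and empty: "{} \<in> D"
    and compl: "\<And>A. A \<in> D \<Longrightarrow> space M - A \<in> D" and un: "\<And>A B. A \<in> D \<Longrightarrow> B \<in> D \<Longrightarrow> A \<union> B \<in> D"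
    and "A \<in> sigma_sets (space M) C" "\<epsilon> > 0"
  shows "\<exists>B\<in>D. measure M ((A - B) \<union> (B - A)) < \<epsilon>"
  using assms(6,7)
proof (induction arbitrary: \<epsilon> rule: sigma_sets.induct)
  case (Basic A)
  then show ?case using C by (intro bexI[of _ A]) auto
next
  case Empty
  then show ?case using empty by (intro bexI[of _ "{}"]) auto
next
  case (Compl A)
  obtain B where B: "B \<in> D" "measure M ((A - B) \<union> (B - A)) < \<epsilon>" using Compl.IH[OF Compl.prems] by auto
  have "C \<subseteq> Pow (space M)" using C sets.space_closed[of M] by (meson order_trans)
  then have "A \<subseteq> space M" using Compl.hyps by (rule sigma_sets_into_sp)
  moreover have "B \<subseteq> space M" using B(1) C(2) by (intro sets.sets_into_space) (rule subsetD)
  ultimately have "(space M - A - (space M - B)) \<union> (space M - B - (space M - A)) = (A - B) \<union> (B - A)" by blast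
  with B compl show ?case by (intro bexI[of _ "space M - B"]) auto
next
  case (Union A)
  have A: "A i \<in> sets M" for i using Union(1)[of i] C by (meson order_trans sets.sigma_sets_subset subsetD)
  have fin: "\<exists>B\<in>D. measure M (((\<Union>i<n. A i) - B) \<union> (B - (\<Union>i<n. A i))) < \<delta>" if "\<delta> > 0" for n \<delta>
    using that
  proof (induction n arbitrary: \<delta>)
    case 0
    then show ?case using empty by (intro bexI[of _ "{}"]) auto
  next
    case (Suc n)
    let ?U = "\<Union>i<n. A i"
    obtain B where B: "B \<in> D" "measure M ((?U - B) \<union> (B - ?U)) < \<delta> / 2" using Suc.IH[of "\<delta>/2"] Suc.prems by auto
    obtain B' where B': "B' \<in> D" "measure M ((A n - B') \<union> (B' - A n)) < \<delta> / 2"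
      using Union.IH[of "\<delta>/2" n] Suc.prems by auto
    have [measurable]: "B \<in> sets M" "B' \<in> sets M" "A i \<in> sets M" for i using A B B' C by auto
    have "measure M (((\<Union>i<Suc n. A i) - (B \<union> B')) \<union> ((B \<union> B') - (\<Union>i<Suc n. A i)))
      \<le> measure M (((?U - B) \<union> (B - ?U)) \<union> ((A n - B') \<union> (B' - A n)))"
      by (intro finite_measure_mono) (auto simp: lessThan_Suc)
    also have "\<dots> \<le> measure M ((?U - B) \<union> (B - ?U)) + measure M ((A n - B') \<union> (B' - A n))"
      by (intro measure_Un_le) auto
    also have "\<dots> < \<delta>" using B B' by simp
    finally show ?case using un[OF B(1) B'(1)] by blast
  qed
  have inc: "incseq (\<lambda>n. \<Union>i<n. A i)" by (intro monoI) force
  have "(\<lambda>n. measure M (\<Union>i<n. A i)) \<longlonglongrightarrow> measure M (\<Union>n. \<Union>i<n. A i)"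
    using A by (intro finite_Lim_measure_incseq inc) auto
  moreover have eq: "(\<Union>n. \<Union>i<n. A i) = (\<Union>i. A i)" by auto
  ultimately have "\<forall>\<^sub>F n in sequentially. measure M (\<Union>i. A i) - \<epsilon> / 2 < measure M (\<Union>i<n. A i)"
    using Union.prems by (intro order_tendstoD(1)) auto
  then obtain n where n: "measure M (\<Union>i. A i) - \<epsilon> / 2 < measure M (\<Union>i<n. A i)"
    by (auto simp: eventually_sequentially)
  let ?U = "\<Union>i<n. A i"
  obtain B where B: "B \<in> D" "measure M ((?U - B) \<union> (B - ?U)) < \<epsilon> / 2" using fin[of "\<epsilon>/2" n] Union.prems by auto
  have [measurable]: "B \<in> sets M" "A i \<in> sets M" for i using A B C by auto
  have "measure M (((\<Union>i. A i) - ?U) \<union> (?U - (\<Union>i. A i))) = measure M ((\<Union>i. A i) - ?U)"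
    by (intro arg_cong[of _ _ "measure M"]) auto
  also have "\<dots> = measure M (\<Union>i. A i) - measure M ?U"
    by (intro finite_measure_Diff) auto
  also have "\<dots> < \<epsilon> / 2" using n by simp
  finally have "measure M (((\<Union>i. A i) - B) \<union> (B - (\<Union>i. A i))) < \<epsilon>"
    using measure_sym_diff_triangle[of "\<Union>i. A i" ?U B] B by simp
  with B show ?case by blast
qed

text \<open>A subspace of a separable pseudometric space is separable. The members of the countable
  algebra need not belong to \<open>S\<close>, so they are replaced by nearby members of
  \<open>S\<close>.\<close>

lemma (in finite_measure) countably_generated_subset_separable:
  assumes C: "countable C" "C \<subseteq> sets M" and S: "S \<subseteq> sigma_sets (space M) C" "S \<noteq> {}"
  shows "\<exists>A :: nat \<Rightarrow> 'a set. range A \<subseteq> S \<and> (\<forall>B\<in>S. \<forall>\<epsilon>>0. \<exists>n. measure M ((B - A n) \<union> (A n - B)) < \<epsilon>)"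
proof -
  from countable_algebra_generated[OF C(1), of "space M"]
  obtain D where D: "countable D" "C \<subseteq> D" "{} \<in> D" "\<forall>A\<in>D. space M - A \<in> D"
    "\<forall>A\<in>D. \<forall>B\<in>D. A \<union> B \<in> D" "D \<subseteq> sigma_sets (space M) C"
    by (elim exE conjE)
  have sub: "sigma_sets (space M) C \<subseteq> sets M" by (rule sets.sigma_sets_subset[OF C(2)])
  define d where "d A B = measure M ((A - B) \<union> (B - A))" for A B
  have d_sym: "d A B = d B A" for A B by (simp add: d_def Un_commute)
  \<comment> \<open>For an algebra member \<open>E\<close> and a level \<open>n\<close> this is some
    element of \<open>S\<close> within \<open>1 / (n + 1)\<close> of \<open>E\<close>. The choice is
    meaningful only on \<open>P\<close>, the pairs for which such an element exists.\<close>
  define pick where "pick p = (SOME A. A \<in> S \<and> d (fst p) A < inverse (real (Suc (snd p))))" for p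
  define P where "P = {p \<in> D \<times> UNIV. \<exists>A. A \<in> S \<and> d (fst p) A < inverse (real (Suc (snd p)))}"
  have pick: "pick p \<in> S" "d (fst p) (pick p) < inverse (real (Suc (snd p)))" if "p \<in> P" for p
    using someI_ex[of "\<lambda>A. A \<in> S \<and> d (fst p) A < inverse (real (Suc (snd p)))"] that
    by (auto simp: P_def pick_def)
  have dense: "\<exists>p\<in>P. d B (pick p) < \<epsilon>" if B: "B \<in> S" and e: "\<epsilon> > 0" for B \<epsilon>
  proof -
    obtain n where n: "inverse (real (Suc n)) < \<epsilon> / 2" using reals_Archimedean[of "\<epsilon> / 2"] e by auto
    have "D \<subseteq> sets M" using D(6) sub by (rule order_trans)
    moreover have "B \<in> sigma_sets (space M) C" using S(1) B by (rule subsetD)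
    moreover have "0 < inverse (real (Suc n))" by simp
    ultimately have "\<exists>E\<in>D. d B E < inverse (real (Suc n))"
      unfolding d_def using D(2-5) by (intro sigma_sets_approx_by_algebra[of C D]) simp_all
    then obtain E where E: "E \<in> D" "d B E < inverse (real (Suc n))" by (elim bexE)
    \<comment> \<open>\<open>B\<close> itself is an element of \<open>S\<close> close to
      \<open>E\<close>, so the pair is admissible; the chosen element is then within twice
      \<open>1 / (n + 1)\<close> of \<open>B\<close>.\<close>
    have p: "(E, n) \<in> P" unfolding P_def
      using E B by (intro CollectI conjI exI[of _ B]) (simp_all add: d_sym[of E B])
    have "B \<in> sets M" "E \<in> sets M" "pick (E, n) \<in> sets M"
      using B E(1) pick(1)[OF p] D(6) S(1) sub by (meson subsetD)+
    then have "d B (pick (E, n)) \<le> d B E + d E (pick (E, n))"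
      unfolding d_def by (rule measure_sym_diff_triangle)
    also have "\<dots> < \<epsilon>" using pick(2)[OF p] E(2) n by simp
    finally show ?thesis using p by (intro bexI[of _ "(E, n)"])
  qed
  obtain B where "B \<in> S" using S(2) by (meson ex_in_conv)
  then have "P \<noteq> {}" using dense[of B 1] by force
  moreover have "countable P"
    unfolding P_def by (rule countable_subset[of _ "D \<times> UNIV"]) (use D(1) in auto)
  ultimately have "range (from_nat_into P) = P" by (rule range_from_nat_into)
  then have surj: "\<exists>n. p = from_nat_into P n" if "p \<in> P" for p using that by (metis rangeE)
  show ?thesis
  proof (intro exI[of _ "\<lambda>n. pick (from_nat_into P n)"] conjI ballI allI impI)
    show "range (\<lambda>n. pick (from_nat_into P n)) \<subseteq> S"
      using pick(1) from_nat_into[OF \<open>P \<noteq> {}\<close>] by blast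
    show "\<exists>n. measure M ((B - pick (from_nat_into P n)) \<union> (pick (from_nat_into P n) - B)) < \<epsilon>"
      if "B \<in> S" "\<epsilon> > 0" for B \<epsilon>
      using dense[OF that] surj unfolding d_def by metis
  qed
qed

section \<open>Density in \<open>L\<^sup>1\<close>\<close>

text \<open>The linear span, given by rules so that bilinear statements about generators extend by
  induction.\<close>

inductive_set fspan :: "('a \<Rightarrow> real) set \<Rightarrow> ('a \<Rightarrow> real) set" for G where
  base: "g \<in> G \<Longrightarrow> g \<in> fspan G"
| add: "f \<in> fspan G \<Longrightarrow> g \<in> fspan G \<Longrightarrow> (\<lambda>\<omega>. f \<omega> + g \<omega>) \<in> fspan G"
| scale: "f \<in> fspan G \<Longrightarrow> (\<lambda>\<omega>. c * f \<omega>) \<in> fspan G"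

definition bdd_fun :: "'a measure \<Rightarrow> ('a \<Rightarrow> real) \<Rightarrow> bool" where
  "bdd_fun M f \<longleftrightarrow> f \<in> borel_measurable M \<and> (\<exists>K. \<forall>\<omega>\<in>space M. \<bar>f \<omega>\<bar> \<le> K)"

definition L1_closure :: "'a measure \<Rightarrow> ('a \<Rightarrow> real) set \<Rightarrow> ('a \<Rightarrow> real) set" where
  "L1_closure M G = {f. bdd_fun M f \<and> (\<forall>\<epsilon>>0. \<exists>p\<in>fspan G. (\<integral>\<omega>. \<bar>f \<omega> - p \<omega>\<bar> \<partial>M) < \<epsilon>)}"

lemma bdd_funD: "bdd_fun M f \<Longrightarrow> f \<in> borel_measurable M"
  by (simp add: bdd_fun_def)

lemma bdd_fun_const [simp]: "bdd_fun M (\<lambda>\<omega>. c)"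
  by (auto simp: bdd_fun_def)

lemma bdd_fun_add:
  assumes "bdd_fun M f" "bdd_fun M g" shows "bdd_fun M (\<lambda>\<omega>. f \<omega> + g \<omega>)"
proof -
  obtain K L where "\<And>\<omega>. \<omega> \<in> space M \<Longrightarrow> \<bar>f \<omega>\<bar> \<le> K" "\<And>\<omega>. \<omega> \<in> space M \<Longrightarrow> \<bar>g \<omega>\<bar> \<le> L"
    using assms by (auto simp: bdd_fun_def)
  then have "\<forall>\<omega>\<in>space M. \<bar>f \<omega> + g \<omega>\<bar> \<le> K + L"
    by (intro ballI abs_triangle_ineq[THEN order_trans] add_mono) auto
  with assms show ?thesis by (auto simp: bdd_fun_def)
qed

lemma bdd_fun_mult:
  assumes "bdd_fun M f" "bdd_fun M g" shows "bdd_fun M (\<lambda>\<omega>. f \<omega> * g \<omega>)"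
proof -
  obtain K L where "\<And>\<omega>. \<omega> \<in> space M \<Longrightarrow> \<bar>f \<omega>\<bar> \<le> K" "\<And>\<omega>. \<omega> \<in> space M \<Longrightarrow> \<bar>g \<omega>\<bar> \<le> L"
    using assms by (auto simp: bdd_fun_def)
  then have "\<forall>\<omega>\<in>space M. \<bar>f \<omega> * g \<omega>\<bar> \<le> \<bar>K\<bar> * \<bar>L\<bar>" unfolding abs_mult
    by (intro ballI mult_mono) (auto intro: order_trans[OF _ abs_ge_self])
  with assms show ?thesis by (auto simp: bdd_fun_def)
qed

lemma bdd_fun_diff: "bdd_fun M f \<Longrightarrow> bdd_fun M g \<Longrightarrow> bdd_fun M (\<lambda>\<omega>. f \<omega> - g \<omega>)"
  using bdd_fun_add[OF _ bdd_fun_mult[OF bdd_fun_const[of M "-1"]], of f g] by simp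

lemma bdd_fun_abs: "bdd_fun M f \<Longrightarrow> bdd_fun M (\<lambda>\<omega>. \<bar>f \<omega>\<bar>)"
  by (auto simp: bdd_fun_def)

lemma bdd_fun_indicator: "A \<in> sets M \<Longrightarrow> bdd_fun M (indicator A)"
  by (auto simp: bdd_fun_def indicator_def intro!: exI[of _ 1])

lemma bdd_fun_cos: "Y \<in> borel_measurable M \<Longrightarrow> bdd_fun M (\<lambda>\<omega>. cos (Y \<omega>))"
  by (auto simp: bdd_fun_def intro!: exI[of _ 1])

lemma bdd_fun_sin: "Y \<in> borel_measurable M \<Longrightarrow> bdd_fun M (\<lambda>\<omega>. sin (Y \<omega>))"
  by (auto simp: bdd_fun_def intro!: exI[of _ 1])

lemma bdd_fun_subalgebra:
  "space N = space M \<Longrightarrow> sets N \<subseteq> sets M \<Longrightarrow> bdd_fun N f \<Longrightarrow> bdd_fun M f"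
  unfolding bdd_fun_def by (auto intro: measurable_mono[THEN subsetD, of borel borel N M])

lemma bdd_fun_fspan:
  assumes "f \<in> fspan G" "\<And>g. g \<in> G \<Longrightarrow> bdd_fun M g"
  shows "bdd_fun M f"
  using assms(1) by induction (auto intro: assms(2) bdd_fun_add bdd_fun_mult)

lemma fspan_mult:
  assumes mult: "\<And>g h. g \<in> G \<Longrightarrow> h \<in> G \<Longrightarrow> (\<lambda>\<omega>. g \<omega> * h \<omega>) \<in> fspan G"
    and "f \<in> fspan G" "g \<in> fspan G"
  shows "(\<lambda>\<omega>. f \<omega> * g \<omega>) \<in> fspan G"
  using assms(2)
proof induction
  case (base h)
  from assms(3) show ?case
  proof induction
    case (base k)
    then show ?case using mult \<open>h \<in> G\<close> by blast
  next
    case (add k l)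
    from fspan.add[OF add.IH] show ?case by (simp add: distrib_left)
  next
    case (scale k c)
    from fspan.scale[OF scale.IH, of c] show ?case by (simp add: mult.left_commute)
  qed
next
  case (add k l)
  from fspan.add[OF add.IH] show ?case by (simp add: distrib_right)
next
  case (scale k c)
  from fspan.scale[OF scale.IH, of c] show ?case by (simp add: mult.assoc)
qed

context finite_measure
begin

lemma bdd_fun_integrable: "bdd_fun M f \<Longrightarrow> integrable M f"
  unfolding bdd_fun_def by (elim conjE exE) (rule integrable_const_bound, auto)

lemma L1_triangle:
  assumes "bdd_fun M f" "bdd_fun M g" "bdd_fun M h"
  shows "(\<integral>\<omega>. \<bar>f \<omega> - h \<omega>\<bar> \<partial>M) \<le> (\<integral>\<omega>. \<bar>f \<omega> - g \<omega>\<bar> \<partial>M) + (\<integral>\<omega>. \<bar>g \<omega> - h \<omega>\<bar> \<partial>M)"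
proof -
  have "(\<integral>\<omega>. \<bar>f \<omega> - h \<omega>\<bar> \<partial>M) \<le> (\<integral>\<omega>. \<bar>f \<omega> - g \<omega>\<bar> + \<bar>g \<omega> - h \<omega>\<bar> \<partial>M)"
    by (intro integral_mono bdd_fun_integrable bdd_fun_abs bdd_fun_add bdd_fun_diff assms) auto
  also have "\<dots> = (\<integral>\<omega>. \<bar>f \<omega> - g \<omega>\<bar> \<partial>M) + (\<integral>\<omega>. \<bar>g \<omega> - h \<omega>\<bar> \<partial>M)"
    by (intro Bochner_Integration.integral_add bdd_fun_integrable bdd_fun_abs bdd_fun_diff assms)
  finally show ?thesis .
qed

lemma L1_mult_bound:
  assumes "bdd_fun M f" "bdd_fun M g" "bdd_fun M h" "\<And>\<omega>. \<omega> \<in> space M \<Longrightarrow> \<bar>h \<omega>\<bar> \<le> K"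
  shows "(\<integral>\<omega>. \<bar>f \<omega> * h \<omega> - g \<omega> * h \<omega>\<bar> \<partial>M) \<le> K * (\<integral>\<omega>. \<bar>f \<omega> - g \<omega>\<bar> \<partial>M)"
proof -
  have "(\<integral>\<omega>. \<bar>f \<omega> * h \<omega> - g \<omega> * h \<omega>\<bar> \<partial>M) \<le> (\<integral>\<omega>. K * \<bar>f \<omega> - g \<omega>\<bar> \<partial>M)"
  proof (intro integral_mono bdd_fun_integrable bdd_fun_abs bdd_fun_diff bdd_fun_mult assms(1-3) bdd_fun_const)
    fix \<omega> assume "\<omega> \<in> space M"
    then show "\<bar>f \<omega> * h \<omega> - g \<omega> * h \<omega>\<bar> \<le> K * \<bar>f \<omega> - g \<omega>\<bar>"
      using mult_right_mono[OF assms(4), of \<omega> "\<bar>f \<omega> - g \<omega>\<bar>"]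
      by (simp add: abs_mult mult.commute flip: left_diff_distrib)
  qed
  then show ?thesis by simp
qed

end

section \<open>A monotone class argument in L^1\<close>

text \<open>Continuous ramps that converge to the indicator of the open half-line; they carry the
  step from functions to level sets.\<close>

lemma tendsto_cutoff: "(\<lambda>n. min 1 (real n * max 0 x)) \<longlonglongrightarrow> (if x > 0 then 1 else 0)"
proof (cases "x > 0")
  case True
  obtain m where "1 / x < real m" using reals_Archimedean2 by blast
  then have "min 1 (real n * max 0 x) = 1" if "n \<ge> m" for n
  proof -
    have "1 / x \<le> real n" using that \<open>1 / x < real m\<close> by linarith
    then show ?thesis using True by (simp add: field_simps)
  qed
  then have "\<forall>\<^sub>F n in sequentially. min 1 (real n * max 0 x) = 1" by (auto simp: eventually_sequentially)
  then show ?thesis using True by (simp add: tendsto_eventually)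
qed simp

text \<open>The generators span a unital algebra of bounded functions. The aim is to show that the
  events whose indicators lie in the L^1 closure form a sigma-algebra for which every function of
  the closure is measurable.\<close>

locale function_algebra = finite_measure M for M :: "'a measure" +
  fixes G :: "('a \<Rightarrow> real) set"
  assumes bdd_G: "g \<in> G \<Longrightarrow> bdd_fun M g"
    and mult_G: "g \<in> G \<Longrightarrow> h \<in> G \<Longrightarrow> (\<lambda>\<omega>. g \<omega> * h \<omega>) \<in> fspan G"
    and one_fspan: "(\<lambda>\<omega>. 1) \<in> fspan G"
begin

lemma bdd_fspan: "f \<in> fspan G \<Longrightarrow> bdd_fun M f"
  by (rule bdd_fun_fspan) (auto intro: bdd_G)

lemma fspan_subset_closure: "f \<in> fspan G \<Longrightarrow> f \<in> L1_closure M G"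
  by (auto simp: L1_closure_def bdd_fspan intro!: bexI[of _ f])

lemma closure_bdd: "f \<in> L1_closure M G \<Longrightarrow> bdd_fun M f"
  by (simp add: L1_closure_def)

lemma closure_closed:
  assumes "bdd_fun M f" "\<And>\<epsilon>. \<epsilon> > 0 \<Longrightarrow> \<exists>g\<in>L1_closure M G. (\<integral>\<omega>. \<bar>f \<omega> - g \<omega>\<bar> \<partial>M) < \<epsilon>"
  shows "f \<in> L1_closure M G"
  unfolding L1_closure_def
proof (intro CollectI conjI allI impI assms(1))
  fix \<epsilon> :: real assume e: "\<epsilon> > 0"
  then obtain g where g: "g \<in> L1_closure M G" "(\<integral>\<omega>. \<bar>f \<omega> - g \<omega>\<bar> \<partial>M) < \<epsilon> / 2"
    using assms(2)[of "\<epsilon> / 2"] by auto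
  then obtain p where p: "p \<in> fspan G" "(\<integral>\<omega>. \<bar>g \<omega> - p \<omega>\<bar> \<partial>M) < \<epsilon> / 2"
    using e unfolding L1_closure_def by (auto dest!: spec[of _ "\<epsilon> / 2"])
  have "(\<integral>\<omega>. \<bar>f \<omega> - p \<omega>\<bar> \<partial>M) < \<epsilon>"
    using L1_triangle[OF assms(1) closure_bdd[OF g(1)] bdd_fspan[OF p(1)]] g p by simp
  with p show "\<exists>p\<in>fspan G. (\<integral>\<omega>. \<bar>f \<omega> - p \<omega>\<bar> \<partial>M) < \<epsilon>" by blast
qed

lemma closure_scale:
  assumes "f \<in> L1_closure M G" shows "(\<lambda>\<omega>. c * f \<omega>) \<in> L1_closure M G"
proof (rule closure_closed)
  show "bdd_fun M (\<lambda>\<omega>. c * f \<omega>)" using closure_bdd[OF assms] by (intro bdd_fun_mult) auto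
  fix \<epsilon> :: real assume e: "\<epsilon> > 0"
  then have "\<epsilon> / (\<bar>c\<bar> + 1) > 0" by simp
  then obtain p where p: "p \<in> fspan G" "(\<integral>\<omega>. \<bar>f \<omega> - p \<omega>\<bar> \<partial>M) < \<epsilon> / (\<bar>c\<bar> + 1)"
    using assms unfolding L1_closure_def by blast
  have "(\<integral>\<omega>. \<bar>c * f \<omega> - c * p \<omega>\<bar> \<partial>M) = \<bar>c\<bar> * (\<integral>\<omega>. \<bar>f \<omega> - p \<omega>\<bar> \<partial>M)"
    by (simp add: abs_mult flip: right_diff_distrib)
  also have "\<dots> \<le> (\<bar>c\<bar> + 1) * (\<integral>\<omega>. \<bar>f \<omega> - p \<omega>\<bar> \<partial>M)" by (intro mult_right_mono) auto
  also have "\<dots> < \<epsilon>" using p(2) by (simp add: field_simps)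
  finally show "\<exists>g\<in>L1_closure M G. (\<integral>\<omega>. \<bar>c * f \<omega> - g \<omega>\<bar> \<partial>M) < \<epsilon>"
    using fspan.scale[OF p(1), of c] by (intro bexI[of _ "\<lambda>\<omega>. c * p \<omega>"] fspan_subset_closure)
qed

lemma closure_add:
  assumes f: "f \<in> L1_closure M G" and g: "g \<in> L1_closure M G" shows "(\<lambda>\<omega>. f \<omega> + g \<omega>) \<in> L1_closure M G"
proof (rule closure_closed)
  show "bdd_fun M (\<lambda>\<omega>. f \<omega> + g \<omega>)" using f g by (intro bdd_fun_add closure_bdd)
  fix \<epsilon> :: real assume "\<epsilon> > 0"
  then have e: "\<epsilon> / 2 > 0" by simp
  obtain p where p: "p \<in> fspan G" "(\<integral>\<omega>. \<bar>f \<omega> - p \<omega>\<bar> \<partial>M) < \<epsilon> / 2"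
    using f e unfolding L1_closure_def by blast
  obtain q where q: "q \<in> fspan G" "(\<integral>\<omega>. \<bar>g \<omega> - q \<omega>\<bar> \<partial>M) < \<epsilon> / 2"
    using g e unfolding L1_closure_def by blast
  note b = closure_bdd[OF f] closure_bdd[OF g] bdd_fspan[OF p(1)] bdd_fspan[OF q(1)]
  have "(\<integral>\<omega>. \<bar>(f \<omega> + g \<omega>) - (p \<omega> + q \<omega>)\<bar> \<partial>M) \<le> (\<integral>\<omega>. \<bar>f \<omega> - p \<omega>\<bar> + \<bar>g \<omega> - q \<omega>\<bar> \<partial>M)"
    by (intro integral_mono bdd_fun_integrable bdd_fun_abs bdd_fun_add bdd_fun_diff b) auto
  also have "\<dots> = (\<integral>\<omega>. \<bar>f \<omega> - p \<omega>\<bar> \<partial>M) + (\<integral>\<omega>. \<bar>g \<omega> - q \<omega>\<bar> \<partial>M)"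
    by (intro Bochner_Integration.integral_add bdd_fun_integrable bdd_fun_abs bdd_fun_diff b)
  also have "\<dots> < \<epsilon>" using p q by simp
  finally show "\<exists>h\<in>L1_closure M G. (\<integral>\<omega>. \<bar>f \<omega> + g \<omega> - h \<omega>\<bar> \<partial>M) < \<epsilon>"
    using fspan.add[OF p(1) q(1)] by (intro bexI[of _ "\<lambda>\<omega>. p \<omega> + q \<omega>"] fspan_subset_closure)
qed

text \<open>The factors of a product must be approximated one after the other, since the
  approximants of one factor may be unbounded as a family. \<open>closure_mult\<close> applies this
  first with \<open>h\<close> in the span, then with \<open>h\<close> in the closure.\<close>

lemma closure_mult_bdd:
  assumes f: "f \<in> L1_closure M G" and h: "bdd_fun M h"
    and mem: "\<And>p. p \<in> fspan G \<Longrightarrow> (\<lambda>\<omega>. p \<omega> * h \<omega>) \<in> L1_closure M G"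
  shows "(\<lambda>\<omega>. f \<omega> * h \<omega>) \<in> L1_closure M G"
proof (rule closure_closed)
  show "bdd_fun M (\<lambda>\<omega>. f \<omega> * h \<omega>)" by (intro bdd_fun_mult closure_bdd[OF f] h)
  obtain K0 where K0: "\<And>\<omega>. \<omega> \<in> space M \<Longrightarrow> \<bar>h \<omega>\<bar> \<le> K0" using h by (auto simp: bdd_fun_def)
  define K where "K = \<bar>K0\<bar> + 1"
  have K: "K > 0" "\<And>\<omega>. \<omega> \<in> space M \<Longrightarrow> \<bar>h \<omega>\<bar> \<le> K" using K0 by (fastforce simp: K_def)+
  fix \<epsilon> :: real assume "\<epsilon> > 0"
  then have "\<epsilon> / K > 0" using K by simp
  then obtain p where p: "p \<in> fspan G" "(\<integral>\<omega>. \<bar>f \<omega> - p \<omega>\<bar> \<partial>M) < \<epsilon> / K"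
    using f unfolding L1_closure_def by blast
  have "(\<integral>\<omega>. \<bar>f \<omega> * h \<omega> - p \<omega> * h \<omega>\<bar> \<partial>M) \<le> K * (\<integral>\<omega>. \<bar>f \<omega> - p \<omega>\<bar> \<partial>M)"
    by (intro L1_mult_bound closure_bdd[OF f] bdd_fspan[OF p(1)] h K(2))
  also have "\<dots> < \<epsilon>" using p(2) K(1) by (simp add: field_simps)
  finally show "\<exists>g\<in>L1_closure M G. (\<integral>\<omega>. \<bar>f \<omega> * h \<omega> - g \<omega>\<bar> \<partial>M) < \<epsilon>"
    using mem[OF p(1)] by (intro bexI[of _ "\<lambda>\<omega>. p \<omega> * h \<omega>"])
qed

lemma closure_mult:
  assumes f: "f \<in> L1_closure M G" and g: "g \<in> L1_closure M G"
  shows "(\<lambda>\<omega>. f \<omega> * g \<omega>) \<in> L1_closure M G"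
proof (rule closure_mult_bdd[OF f closure_bdd[OF g]])
  fix p assume p: "p \<in> fspan G"
  have "(\<lambda>\<omega>. g \<omega> * p \<omega>) \<in> L1_closure M G"
    by (rule closure_mult_bdd[OF g bdd_fspan[OF p]], rule fspan_subset_closure, rule fspan_mult[OF mult_G _ p])
  then show "(\<lambda>\<omega>. p \<omega> * g \<omega>) \<in> L1_closure M G" by (simp add: mult.commute)
qed

lemma closure_one: "(\<lambda>\<omega>. 1) \<in> L1_closure M G"
  by (rule fspan_subset_closure[OF one_fspan])

lemma closure_const: "(\<lambda>\<omega>. c) \<in> L1_closure M G"
  using closure_scale[OF closure_one, of c] by simp

text \<open>Dominated convergence with the constant \<open>2 * K\<close> turns bounded pointwise
  limits into L^1 limits.\<close>

lemma closure_bounded_limit: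
  assumes mem: "\<And>n. f n \<in> L1_closure M G"
    and bound: "\<And>n \<omega>. \<omega> \<in> space M \<Longrightarrow> \<bar>f n \<omega>\<bar> \<le> K"
    and lim: "\<And>\<omega>. \<omega> \<in> space M \<Longrightarrow> (\<lambda>n. f n \<omega>) \<longlonglongrightarrow> g \<omega>"
  shows "g \<in> L1_closure M G"
proof (rule closure_closed)
  have [measurable]: "f n \<in> borel_measurable M" for n using closure_bdd[OF mem] by (rule bdd_funD)
  have [measurable]: "g \<in> borel_measurable M" by (rule borel_measurable_LIMSEQ_real[OF lim]) auto
  have gK: "\<bar>g \<omega>\<bar> \<le> K" if "\<omega> \<in> space M" for \<omega>
    using tendsto_rabs[OF lim[OF that]] bound[OF that] by (intro LIMSEQ_le_const2) auto
  then show "bdd_fun M g" by (auto simp: bdd_fun_def)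
  have "(\<lambda>n. \<integral>\<omega>. \<bar>g \<omega> - f n \<omega>\<bar> \<partial>M) \<longlonglongrightarrow> (\<integral>\<omega>. 0 \<partial>M)"
  proof (rule integral_dominated_convergence[where w="\<lambda>_. 2 * K"])
    show "AE \<omega> in M. (\<lambda>n. \<bar>g \<omega> - f n \<omega>\<bar>) \<longlonglongrightarrow> 0"
    proof (intro AE_I2)
      fix \<omega> assume "\<omega> \<in> space M"
      from tendsto_rabs[OF tendsto_diff[OF tendsto_const lim[OF this], of "g \<omega>"]]
      show "(\<lambda>n. \<bar>g \<omega> - f n \<omega>\<bar>) \<longlonglongrightarrow> 0" by simp
    qed
    show "AE \<omega> in M. norm \<bar>g \<omega> - f n \<omega>\<bar> \<le> 2 * K" for n
    proof (intro AE_I2)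
      fix \<omega> assume "\<omega> \<in> space M"
      from gK[OF this] bound[OF this, of n] show "norm \<bar>g \<omega> - f n \<omega>\<bar> \<le> 2 * K" by simp
    qed
  qed auto
  then have lim0: "(\<lambda>n. \<integral>\<omega>. \<bar>g \<omega> - f n \<omega>\<bar> \<partial>M) \<longlonglongrightarrow> 0" by simp
  fix \<epsilon> :: real assume "\<epsilon> > 0"
  then have "\<forall>\<^sub>F n in sequentially. (\<integral>\<omega>. \<bar>g \<omega> - f n \<omega>\<bar> \<partial>M) < \<epsilon>" using lim0 by (intro order_tendstoD) auto
  then show "\<exists>h\<in>L1_closure M G. (\<integral>\<omega>. \<bar>g \<omega> - h \<omega>\<bar> \<partial>M) < \<epsilon>"
    using mem by (auto simp: eventually_sequentially)
qed

definition closure_sets :: "'a set set" where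
  "closure_sets = {A \<in> sets M. indicator A \<in> L1_closure M G}"

text \<open>Needed because identities between indicators, such as that for a complement, hold only
  on \<open>space M\<close>. A constant sequence is fed into the limit lemma.\<close>

lemma closure_cong:
  assumes "f \<in> L1_closure M G" "\<And>\<omega>. \<omega> \<in> space M \<Longrightarrow> f \<omega> = g \<omega>"
  shows "g \<in> L1_closure M G"
proof -
  obtain K where "\<And>\<omega>. \<omega> \<in> space M \<Longrightarrow> \<bar>f \<omega>\<bar> \<le> K" using closure_bdd[OF assms(1)] by (auto simp: bdd_fun_def)
  then show ?thesis
  proof (rule closure_bounded_limit[of "\<lambda>_. f", OF assms(1)])
    show "(\<lambda>n. f \<omega>) \<longlonglongrightarrow> g \<omega>" if "\<omega> \<in> space M" for \<omega> unfolding assms(2)[OF that] by (rule tendsto_const)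
  qed
qed

lemma sigma_algebra_closure_sets: "sigma_algebra (space M) closure_sets"
proof -
  have compl: "space M - A \<in> closure_sets" if "A \<in> closure_sets" for A
  proof -
    have "(\<lambda>\<omega>. 1 + (-1) * indicator A \<omega>) \<in> L1_closure M G"
      using that by (intro closure_add closure_scale closure_one) (auto simp: closure_sets_def)
    then have "indicator (space M - A) \<in> L1_closure M G" by (rule closure_cong) (auto simp: indicator_def)
    with that show ?thesis by (auto simp: closure_sets_def)
  qed
  have inter: "A \<inter> B \<in> closure_sets" if "A \<in> closure_sets" "B \<in> closure_sets" for A B
  proof -
    have "(\<lambda>\<omega>. indicator A \<omega> * indicator B \<omega>) \<in> L1_closure M G"
      using that by (intro closure_mult) (auto simp: closure_sets_def)
    then have "indicator (A \<inter> B) \<in> L1_closure M G" by (rule closure_cong) (auto simp: indicator_def)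
    with that show ?thesis by (auto simp: closure_sets_def)
  qed
  have empty: "{} \<in> closure_sets" using closure_const[of 0] by (auto simp: closure_sets_def indicator_def[abs_def])
  have into: "A \<subseteq> space M" if "A \<in> closure_sets" for A
    using that sets.sets_into_space[of A M] by (auto simp: closure_sets_def)
  have un: "A \<union> B \<in> closure_sets" if "A \<in> closure_sets" "B \<in> closure_sets" for A B
  proof -
    have "A \<union> B = space M - ((space M - A) \<inter> (space M - B))" using into[OF that(1)] into[OF that(2)] by auto
    then show ?thesis using that compl inter by metis
  qed
  have alg: "algebra (space M) closure_sets"
    unfolding algebra_iff_Un using empty compl un into by (intro conjI subsetI[of closure_sets] PowI ballI) simp_all
  interpret algebra "space M" closure_sets by (rule alg)
  have "(\<Union>i. A i) \<in> closure_sets" if A: "range A \<subseteq> closure_sets" for A :: "nat \<Rightarrow> 'a set"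
  proof -
    have mem: "(\<Union>i<n. A i) \<in> closure_sets" for n using A by (intro finite_UN) auto
    have "indicator (\<Union>i. A i) \<in> L1_closure M G"
    proof (rule closure_bounded_limit)
      show "indicator (\<Union>i<n. A i) \<in> L1_closure M G" for n using mem[of n] by (simp add: closure_sets_def)
      show "\<bar>indicat_real (\<Union>i<n. A i) \<omega>\<bar> \<le> 1" for n \<omega> by (simp add: indicator_def)
      show "(\<lambda>n. indicat_real (\<Union>i<n. A i) \<omega>) \<longlonglongrightarrow> indicator (\<Union>i. A i) \<omega>" for \<omega>
        by (rule LIMSEQ_indicator_UN)
    qed
    moreover have "(\<Union>i. A i) \<in> sets M" using A by (auto simp: closure_sets_def)
    ultimately show ?thesis by (simp add: closure_sets_def)
  qed
  then show ?thesis by (intro sigma_algebra.intro alg sigma_algebra_axioms.intro)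
qed

lemma closure_polynomial:
  assumes "f \<in> L1_closure M G" "real_polynomial_function q"
  shows "(\<lambda>\<omega>. q (f \<omega>)) \<in> L1_closure M G"
  using assms(2)
proof induction
  case (linear h)
  then interpret bounded_linear h .
  have "h x = h 1 * x" for x using scaleR[of x 1] by simp
  then have "(\<lambda>\<omega>. h (f \<omega>)) = (\<lambda>\<omega>. h 1 * f \<omega>)" by (rule ext)
  then show ?case using closure_scale[OF assms(1)] by simp
qed (auto intro: closure_const closure_add closure_mult)

text \<open>Weierstrass approximation on an interval that contains the range of the bounded
  \<open>f\<close> reduces this to polynomials.\<close>

lemma closure_continuous:
  assumes f: "f \<in> L1_closure M G" and cont: "continuous_on UNIV \<phi>"
  shows "(\<lambda>\<omega>. \<phi> (f \<omega>)) \<in> L1_closure M G"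
proof (rule closure_closed)
  obtain K where "\<And>\<omega>. \<omega> \<in> space M \<Longrightarrow> \<bar>f \<omega>\<bar> \<le> K" using closure_bdd[OF f] by (auto simp: bdd_fun_def)
  then have K: "f \<omega> \<in> {-K..K}" if "\<omega> \<in> space M" for \<omega> using that by (simp add: abs_le_iff minus_le_iff)
  have cont': "continuous_on {-K..K} \<phi>" using cont continuous_on_subset by blast
  have "compact (\<phi> ` {-K..K})" using cont' by (intro compact_continuous_image) auto
  then obtain L where "\<And>y. y \<in> \<phi> ` {-K..K} \<Longrightarrow> norm y \<le> L" using compact_imp_bounded bounded_iff by metis
  then have "\<forall>\<omega>\<in>space M. \<bar>\<phi> (f \<omega>)\<bar> \<le> L" using K by (auto simp del: atLeastAtMost_iff)
  moreover have "(\<lambda>\<omega>. \<phi> (f \<omega>)) \<in> borel_measurable M"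
    using bdd_funD[OF closure_bdd[OF f]] borel_measurable_continuous_onI[OF cont] by (rule measurable_compose)
  ultimately show bdd: "bdd_fun M (\<lambda>\<omega>. \<phi> (f \<omega>))" by (auto simp: bdd_fun_def)
  fix \<epsilon> :: real assume e: "\<epsilon> > 0"
  \<comment> \<open>The added 1 keeps the denominator positive for a zero measure and makes the
    final estimate strict.\<close>
  define \<delta> where "\<delta> = \<epsilon> / (measure M (space M) + 1)"
  have pos: "measure M (space M) + 1 > 0" by (simp add: add_nonneg_pos)
  then have d: "\<delta> > 0" using e by (simp add: \<delta>_def)
  obtain q where q: "real_polynomial_function q" "\<And>x. x \<in> {-K..K} \<Longrightarrow> \<bar>\<phi> x - q x\<bar> < \<delta>"
    using Stone_Weierstrass_real_polynomial_function[OF _ cont' d] by auto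
  have qf: "(\<lambda>\<omega>. q (f \<omega>)) \<in> L1_closure M G" by (rule closure_polynomial[OF f q(1)])
  have "(\<integral>\<omega>. \<bar>\<phi> (f \<omega>) - q (f \<omega>)\<bar> \<partial>M) \<le> (\<integral>\<omega>. \<delta> \<partial>M)"
    using q(2)[OF K]
    by (intro integral_mono bdd_fun_integrable bdd_fun_abs bdd_fun_diff bdd closure_bdd[OF qf]) (auto intro: less_imp_le)
  also have "\<dots> = measure M (space M) * \<delta>" by simp
  also have "\<dots> < (measure M (space M) + 1) * \<delta>" using d by (simp add: algebra_simps)
  also have "\<dots> = \<epsilon>" using pos by (simp add: \<delta>_def)
  finally show "\<exists>g\<in>L1_closure M G. (\<integral>\<omega>. \<bar>\<phi> (f \<omega>) - g \<omega>\<bar> \<partial>M) < \<epsilon>" using qf by (rule bexI)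
qed

lemma closure_greater:
  assumes f: "f \<in> L1_closure M G"
  shows "{\<omega> \<in> space M. c < f \<omega>} \<in> closure_sets"
proof -
  have [measurable]: "f \<in> borel_measurable M" using bdd_funD[OF closure_bdd[OF f]] .
  have "indicator {\<omega> \<in> space M. c < f \<omega>} \<in> L1_closure M G"
  proof (rule closure_bounded_limit)
    show "(\<lambda>\<omega>. min 1 (real n * max 0 (f \<omega> - c))) \<in> L1_closure M G" for n
      by (rule closure_continuous[OF f, of "\<lambda>x. min 1 (real n * max 0 (x - c))"]) (intro continuous_intros)
    show "\<bar>min 1 (real n * max 0 (f \<omega> - c))\<bar> \<le> 1" for n \<omega> by (auto simp: abs_le_iff)
    show "(\<lambda>n. min 1 (real n * max 0 (f \<omega> - c))) \<longlonglongrightarrow> indicator {\<omega> \<in> space M. c < f \<omega>} \<omega>"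
      if "\<omega> \<in> space M" for \<omega>
      using tendsto_cutoff[of "f \<omega> - c"] that by (auto simp: indicator_def)
  qed
  then show ?thesis by (simp add: closure_sets_def)
qed

lemma closure_borel_measurable:
  assumes "f \<in> L1_closure M G"
  shows "f \<in> borel_measurable (sigma (space M) closure_sets)"
proof -
  interpret sigma_algebra "space M" closure_sets by (rule sigma_algebra_closure_sets)
  show ?thesis using closure_greater[OF assms] by (auto simp: borel_measurable_iff_greater)
qed

end

section \<open>Density of trigonometric polynomials and of step functions\<close>

text \<open>Recovers an unbounded \<open>Y\<close> from the bounded functions
  \<open>n sin (Y / n)\<close>, which belong to the span of the cosines.\<close>

lemma real_mult_sin_divide_tendsto: "(\<lambda>n. real (Suc n) * sin (x / real (Suc n))) \<longlonglongrightarrow> x"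
proof (cases "x = 0")
  case False
  have "filterlim (\<lambda>n. x / real (Suc n)) (at 0) sequentially"
    using False by (intro filterlim_atI LIMSEQ_Suc[OF lim_const_over_n]) auto
  moreover have "((\<lambda>h::real. sin h / h) \<longlongrightarrow> 1) (at 0)"
    using DERIV_sin[of "0::real"] by (simp add: DERIV_def)
  ultimately have "(\<lambda>n. sin (x / real (Suc n)) / (x / real (Suc n))) \<longlonglongrightarrow> 1"
    by (rule filterlim_compose[rotated])
  from tendsto_mult_left[OF this, of x]
  have "(\<lambda>n. x * (sin (x / real (Suc n)) / (x / real (Suc n)))) \<longlonglongrightarrow> x" by simp
  moreover have "x * (sin (x / real (Suc n)) / (x / real (Suc n))) = real (Suc n) * sin (x / real (Suc n))" for n
    using False by (simp del: of_nat_Suc)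
  ultimately show ?thesis by (simp only:)
qed simp

text \<open>Real trigonometric monomials. The free phase \<open>b\<close> includes the sines and
  lets products of two monomials be expanded into the same family.\<close>

definition cosines :: "('a \<Rightarrow> real) set \<Rightarrow> ('a \<Rightarrow> real) set" where
  "cosines L = {\<lambda>\<omega>. cos (Y \<omega> + b) | Y b. Y \<in> L}"

lemma cosinesI: "Y \<in> L \<Longrightarrow> (\<lambda>\<omega>. cos (Y \<omega> + b)) \<in> cosines L"
  by (auto simp: cosines_def)

text \<open>The product-to-sum formula makes the span an algebra, as \<open>L\<close> is a linear
  space. Each \<open>Y\<close> in \<open>L\<close> is a pointwise limit of functions in the closure,
  hence measurable for the closure events, which therefore contain everything generated by
  \<open>L\<close>.\<close>

lemma (in finite_measure) indicator_in_L1_closure_cosines: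
  assumes L: "L \<noteq> {}" "\<And>Y. Y \<in> L \<Longrightarrow> Y \<in> borel_measurable M"
    "\<And>Y Z. Y \<in> L \<Longrightarrow> Z \<in> L \<Longrightarrow> (\<lambda>\<omega>. Y \<omega> + Z \<omega>) \<in> L" "\<And>Y c. Y \<in> L \<Longrightarrow> (\<lambda>\<omega>. c * Y \<omega>) \<in> L"
    and A: "A \<in> sigma_sets (space M) {Y -` B \<inter> space M | Y B. Y \<in> L \<and> B \<in> sets borel}"
  shows "indicator A \<in> L1_closure M (cosines L)"
proof -
  interpret function_algebra M "cosines L"
  proof
    show "bdd_fun M g" if "g \<in> cosines L" for g
      using that L(2) by (auto simp: cosines_def intro!: bdd_fun_cos borel_measurable_add)
    show "(\<lambda>\<omega>. g \<omega> * h \<omega>) \<in> fspan (cosines L)" if g: "g \<in> cosines L" and h: "h \<in> cosines L" for g h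
    proof -
      obtain Y b where Y: "Y \<in> L" "g = (\<lambda>\<omega>. cos (Y \<omega> + b))" using g by (auto simp: cosines_def)
      obtain Z c where Z: "Z \<in> L" "h = (\<lambda>\<omega>. cos (Z \<omega> + c))" using h by (auto simp: cosines_def)
      have "(\<lambda>\<omega>. 1/2 * cos ((Y \<omega> + (-1) * Z \<omega>) + (b - c)) + 1/2 * cos ((Y \<omega> + Z \<omega>) + (b + c))) \<in> fspan (cosines L)"
        by (intro fspan.add fspan.scale fspan.base cosinesI[of "\<lambda>\<omega>. Y \<omega> + (-1) * Z \<omega>"]
            cosinesI[of "\<lambda>\<omega>. Y \<omega> + Z \<omega>"] L(3) L(4) Y(1) Z(1))
      moreover have "g \<omega> * h \<omega> = 1/2 * cos ((Y \<omega> + (-1) * Z \<omega>) + (b - c)) + 1/2 * cos ((Y \<omega> + Z \<omega>) + (b + c))" for \<omega>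
        unfolding Y Z cos_times_cos by (simp add: algebra_simps add_divide_distrib)
      ultimately show ?thesis by simp
    qed
    obtain Y where "Y \<in> L" using L by blast
    \<comment> \<open>Scaling by 0 puts the zero function into \<open>L\<close>, and its cosine is
      the constant 1.\<close>
    then have "(\<lambda>\<omega>. cos (0 * Y \<omega> + 0)) \<in> cosines L" by (intro cosinesI[of "\<lambda>\<omega>. 0 * Y \<omega>"] L(4))
    then show "(\<lambda>\<omega>. 1) \<in> fspan (cosines L)" by (auto intro: fspan.base)
  qed
  interpret S: sigma_algebra "space M" closure_sets by (rule sigma_algebra_closure_sets)
  have meas: "Y \<in> borel_measurable (sigma (space M) closure_sets)" if "Y \<in> L" for Y
  proof (rule borel_measurable_LIMSEQ_real)
    show "(\<lambda>n. real (Suc n) * sin (Y \<omega> / real (Suc n))) \<longlonglongrightarrow> Y \<omega>" for \<omega>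
      by (rule real_mult_sin_divide_tendsto)
    fix n
    \<comment> \<open>The phase \<open>- pi / 2\<close> turns the cosine into a sine.\<close>
    have "(\<lambda>\<omega>. cos ((1 / real (Suc n)) * Y \<omega> + (- pi / 2))) \<in> cosines L"
      by (intro cosinesI[of "\<lambda>\<omega>. (1 / real (Suc n)) * Y \<omega>"] L(4) that)
    then have "(\<lambda>\<omega>. real (Suc n) * cos ((1 / real (Suc n)) * Y \<omega> + (- pi / 2))) \<in> L1_closure M (cosines L)"
      by (intro fspan_subset_closure fspan.scale fspan.base)
    then show "(\<lambda>\<omega>. real (Suc n) * sin (Y \<omega> / real (Suc n))) \<in> borel_measurable (sigma (space M) closure_sets)"
      by (intro closure_borel_measurable) (simp add: cos_diff)
  qed
  have "Y -` B \<inter> space M \<in> closure_sets" if "Y \<in> L" "B \<in> sets borel" for Y B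
    using measurable_sets[OF meas[OF that(1)] that(2)] by simp
  then have "A \<in> closure_sets"
    using A S.sigma_sets_subset[of "{Y -` B \<inter> space M | Y B. Y \<in> L \<and> B \<in> sets borel}"] by blast
  then show ?thesis by (simp add: closure_sets_def)
qed

text \<open>Rounding \<open>f\<close> down to multiples of \<open>\<delta>\<close> gives a step
  function with finitely many values at uniform distance at most \<open>\<delta>\<close>. This later
  carries ergodicity from events to bounded functions.\<close>

lemma (in finite_measure) bdd_fun_in_L1_closure_indicators:
  assumes sub: "space N = space M" "sets N \<subseteq> sets M" and f: "bdd_fun N f"
  shows "f \<in> L1_closure M {indicator A | A. A \<in> sets N}"
  unfolding L1_closure_def
proof (intro CollectI conjI allI impI)
  show fM: "bdd_fun M f" by (rule bdd_fun_subalgebra[OF sub f])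
  fix \<epsilon> :: real assume e: "\<epsilon> > 0"
  have [measurable]: "f \<in> borel_measurable N" using f by (rule bdd_funD)
  define \<delta> where "\<delta> = \<epsilon> / (measure M (space M) + 1)"
  have pos: "measure M (space M) + 1 > 0" by (simp add: add_nonneg_pos)
  then have d: "\<delta> > 0" using e by (simp add: \<delta>_def)
  obtain K where K: "\<And>\<omega>. \<omega> \<in> space M \<Longrightarrow> \<bar>f \<omega>\<bar> \<le> K" using fM by (auto simp: bdd_fun_def)
  \<comment> \<open>A finite range that contains all values of
    \<open>\<lfloor>f \<omega> / \<delta>\<rfloor>\<close> when
    \<open>\<bar>f \<omega>\<bar> \<le> K\<close>.\<close>
  define I where "I = {- \<lceil>K / \<delta>\<rceil> - 1 .. \<lceil>K / \<delta>\<rceil>}"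
  define A where "A k = {\<omega> \<in> space N. \<lfloor>f \<omega> / \<delta>\<rfloor> = k}" for k
  have A: "A k \<in> sets N" for k unfolding A_def by measurable
  define p where "p \<omega> = (\<Sum>k\<in>I. (\<delta> * of_int k) * indicator (A k) \<omega>)" for \<omega>
  have fs: "(\<lambda>\<omega>. \<Sum>k\<in>J. (\<delta> * of_int k) * indicator (A k) \<omega>) \<in> fspan {indicator A | A. A \<in> sets N}"
    if "finite J" for J
    using that
  proof induction
    case empty
    have "(\<lambda>\<omega>. 0 * indicator {} \<omega>) \<in> fspan {indicator A | A. A \<in> sets N}"
      by (intro fspan.scale fspan.base) blast
    then show ?case by simp
  next
    case (insert k J)
    have "(\<lambda>\<omega>. (\<delta> * of_int k) * indicator (A k) \<omega> + (\<Sum>k\<in>J. (\<delta> * of_int k) * indicator (A k) \<omega>))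
      \<in> fspan {indicator A | A. A \<in> sets N}"
      using A[of k] by (intro fspan.add[OF _ insert.IH] fspan.scale fspan.base) blast
    then show ?case unfolding sum.insert[OF insert.hyps] .
  qed
  have p: "p \<in> fspan {indicator A | A. A \<in> sets N}" unfolding p_def[abs_def] by (rule fs) (simp add: I_def)
  have p_eq: "p \<omega> = \<delta> * of_int \<lfloor>f \<omega> / \<delta>\<rfloor>" if "\<omega> \<in> space M" for \<omega>
  proof -
    have "f \<omega> / \<delta> \<le> K / \<delta>" "- (K / \<delta>) \<le> f \<omega> / \<delta>" using K[OF that] d by (auto simp: field_simps abs_le_iff)
    then have "\<lfloor>f \<omega> / \<delta>\<rfloor> \<in> I" unfolding I_def by (auto; linarith)
    moreover have "p \<omega> = (\<Sum>k\<in>I. if k = \<lfloor>f \<omega> / \<delta>\<rfloor> then \<delta> * of_int k else 0)"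
      unfolding p_def using that sub by (intro sum.cong) (auto simp: A_def indicator_def)
    ultimately show ?thesis by (simp add: I_def)
  qed
  have "bdd_fun M p" using p by (rule bdd_fun_fspan) (use sub in \<open>auto intro!: bdd_fun_indicator\<close>)
  then have "(\<integral>\<omega>. \<bar>f \<omega> - p \<omega>\<bar> \<partial>M) \<le> (\<integral>\<omega>. \<delta> \<partial>M)"
  proof (intro integral_mono bdd_fun_integrable bdd_fun_abs bdd_fun_diff fM)
    fix \<omega> assume w: "\<omega> \<in> space M"
    have "f \<omega> = \<delta> * (f \<omega> / \<delta>)" using d by simp
    then have "\<bar>f \<omega> - p \<omega>\<bar> = \<delta> * \<bar>f \<omega> / \<delta> - of_int \<lfloor>f \<omega> / \<delta>\<rfloor>\<bar>"
      unfolding p_eq[OF w] using d by (metis abs_mult abs_of_pos right_diff_distrib)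
    also have "\<dots> \<le> \<delta> * 1" using d by (intro mult_left_mono) linarith+
    finally show "\<bar>f \<omega> - p \<omega>\<bar> \<le> \<delta>" by simp
  qed auto
  also have "\<dots> = measure M (space M) * \<delta>" by simp
  also have "\<dots> < (measure M (space M) + 1) * \<delta>" using d by (simp add: algebra_simps)
  also have "\<dots> = \<epsilon>" using pos by (simp add: \<delta>_def)
  finally show "\<exists>p\<in>fspan {indicator A | A. A \<in> sets N}. (\<integral>\<omega>. \<bar>f \<omega> - p \<omega>\<bar> \<partial>M) < \<epsilon>" using p by blast
qed

section \<open>Correlations of a stationary field\<close>

lemma Tset_add: "s \<in> Tset discr \<Longrightarrow> t \<in> Tset discr \<Longrightarrow> s + t \<in> Tset discr"
  by (auto simp: Tset_def)

lemma space_idx_space [simp]: "space (idx_space discr) = Tset discr"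
  by (auto simp: idx_space_def Tset_def)

lemma measurable_idx_space_lam: "f \<in> borel_measurable (idx_space discr) \<Longrightarrow> f \<in> borel_measurable (lam discr)"
  by (auto simp: idx_space_def lam_def intro: measurable_completion)

locale stationary_field = prob_space M for M :: "'a measure" +
  fixes discr :: bool and \<theta> :: "real^'d \<Rightarrow> 'a \<Rightarrow> 'a" and X0 :: "'a \<Rightarrow> real" and X :: "real^'d \<Rightarrow> 'a \<Rightarrow> real"
  assumes action: "mp_action discr M \<theta>"
    and X0 [measurable]: "X0 \<in> borel_measurable M"
    and X_eq: "X t \<omega> = X0 (\<theta> t \<omega>)"
    and X_joint: "(\<lambda>(t, \<omega>). X t \<omega>) \<in> borel_measurable (idx_space discr \<Otimes>\<^sub>M M)"
begin

lemma theta_measurable: "t \<in> Tset discr \<Longrightarrow> \<theta> t \<in> M \<rightarrow>\<^sub>M M"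
  and theta_distr: "t \<in> Tset discr \<Longrightarrow> distr M M (\<theta> t) = M"
  and theta_add: "s \<in> Tset discr \<Longrightarrow> t \<in> Tset discr \<Longrightarrow> \<omega> \<in> space M \<Longrightarrow> \<theta> (s + t) \<omega> = \<theta> s (\<theta> t \<omega>)"
  using action by (auto simp: mp_action_def)

lemma theta_space: "t \<in> Tset discr \<Longrightarrow> \<omega> \<in> space M \<Longrightarrow> \<theta> t \<omega> \<in> space M"
  using measurable_space[OF theta_measurable] .

lemma X_shift: "s \<in> Tset discr \<Longrightarrow> t \<in> Tset discr \<Longrightarrow> \<omega> \<in> space M \<Longrightarrow> X s (\<theta> t \<omega>) = X (s + t) \<omega>"
  by (simp add: X_eq theta_add)

definition gens :: "'a set set" where
  "gens = (\<Union>t\<in>Tset discr. {X t -` A \<inter> space M | A. A \<in> sets borel})"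

text \<open>The family \<open>sigmaX\<close> packaged as a measurable space. Only its sets matter;
  integrals are always taken over \<open>M\<close>.\<close>

definition N :: "'a measure" where
  "N = sigma (space M) gens"

lemma gens_Pow: "gens \<subseteq> Pow (space M)"
  by (auto simp: gens_def)

lemma space_N [simp]: "space N = space M"
  unfolding N_def using gens_Pow by (rule space_measure_of)

lemma sets_N_eq: "sets N = sigma_sets (space M) gens"
  unfolding N_def using gens_Pow by (rule sets_measure_of)

lemma sets_N: "sets N = sigmaX discr M X"
  by (simp add: sets_N_eq sigmaX_def gens_def)

lemma X_measurable_M: "t \<in> Tset discr \<Longrightarrow> X t \<in> borel_measurable M"
  using measurable_compose[OF theta_measurable X0, of t] by (simp add: X_eq[abs_def])

lemma sets_N_subset: "sets N \<subseteq> sets M"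
  unfolding sets_N_eq by (rule sets.sigma_sets_subset) (auto simp: gens_def intro: measurable_sets X_measurable_M)

lemma X_measurable_N:
  assumes "t \<in> Tset discr" shows "X t \<in> borel_measurable N"
proof (rule measurableI)
  fix A :: "real set" assume "A \<in> sets borel"
  then have "X t -` A \<inter> space M \<in> gens" using assms by (auto simp: gens_def)
  then show "X t -` A \<inter> space N \<in> sets N" by (simp add: sets_N_eq sigma_sets.Basic)
qed simp

lemma bdd_fun_NM: "bdd_fun N f \<Longrightarrow> bdd_fun M f"
  by (rule bdd_fun_subalgebra[OF space_N sets_N_subset])

lemma bdd_fun_shift:
  assumes "bdd_fun N f" "t \<in> Tset discr" shows "bdd_fun M (\<lambda>\<omega>. f (\<theta> t \<omega>))"
  using bdd_fun_NM[OF assms(1)] theta_space[OF assms(2)] measurable_compose[OF theta_measurable[OF assms(2)]]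
  unfolding bdd_fun_def by blast

lemma expectation_shift:
  assumes "bdd_fun N f" "t \<in> Tset discr" shows "(\<integral>\<omega>. f (\<theta> t \<omega>) \<partial>M) = (\<integral>\<omega>. f \<omega> \<partial>M)"
  using integral_distr[OF theta_measurable[OF assms(2)] bdd_funD[OF bdd_fun_NM[OF assms(1)]]]
  by (simp add: theta_distr[OF assms(2)])

text \<open>\<open>mp_action\<close> makes each \<open>\<theta> t\<close> measurable separately.
  Joint measurability into the coarser target \<open>N\<close> comes from the field: the preimage of
  an event on \<open>X s\<close> is an event on \<open>X (s + t) \<omega>\<close>, jointly in
  \<open>t\<close> and \<open>\<omega>\<close>.\<close>

lemma theta_joint_measurable: "(\<lambda>(t, \<omega>). \<theta> t \<omega>) \<in> idx_space discr \<Otimes>\<^sub>M M \<rightarrow>\<^sub>M N"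
  unfolding N_def
proof (rule measurable_measure_of[OF gens_Pow])
  show "(\<lambda>(t, \<omega>). \<theta> t \<omega>) \<in> space (idx_space discr \<Otimes>\<^sub>M M) \<rightarrow> space M"
    by (auto simp: space_pair_measure theta_space)
  fix B assume "B \<in> gens"
  then obtain s A where s: "s \<in> Tset discr" and A: "A \<in> sets borel" and B: "B = X s -` A \<inter> space M"
    by (auto simp: gens_def)
  have "(\<lambda>t. s + t) \<in> idx_space discr \<rightarrow>\<^sub>M idx_space discr"
    using Tset_add[OF s] by (cases discr) (auto simp: idx_space_def)
  then have "(\<lambda>p. (s + fst p, snd p)) \<in> idx_space discr \<Otimes>\<^sub>M M \<rightarrow>\<^sub>M idx_space discr \<Otimes>\<^sub>M M"
    by (intro measurable_Pair measurable_compose[OF measurable_fst] measurable_snd)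
  from measurable_compose[OF this X_joint]
  have "(\<lambda>p. X (s + fst p) (snd p)) \<in> borel_measurable (idx_space discr \<Otimes>\<^sub>M M)" by simp
  from measurable_sets[OF this A]
  show "(\<lambda>(t, \<omega>). \<theta> t \<omega>) -` B \<inter> space (idx_space discr \<Otimes>\<^sub>M M) \<in> sets (idx_space discr \<Otimes>\<^sub>M M)"
    by (rule back_subst[of "\<lambda>S. S \<in> sets (idx_space discr \<Otimes>\<^sub>M M)"])
      (auto simp: B space_pair_measure X_shift[OF s] theta_space)
qed

section \<open>Covariances along the action\<close>

text \<open>The covariance of \<open>f\<close> and the shifted \<open>g\<close>, by invariance of
  the measure. The value 0 off the index set lets bilinearity hold as an equality of
  functions.\<close>

definition corr :: "('a \<Rightarrow> real) \<Rightarrow> ('a \<Rightarrow> real) \<Rightarrow> real^'d \<Rightarrow> real" where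
  "corr f g t = (if t \<in> Tset discr then (\<integral>\<omega>. f \<omega> * g (\<theta> t \<omega>) \<partial>M) - (\<integral>\<omega>. f \<omega> \<partial>M) * (\<integral>\<omega>. g \<omega> \<partial>M) else 0)"

lemma integrable_corr:
  "bdd_fun N f \<Longrightarrow> bdd_fun N g \<Longrightarrow> t \<in> Tset discr \<Longrightarrow> integrable M (\<lambda>\<omega>. f \<omega> * g (\<theta> t \<omega>))"
  by (intro bdd_fun_integrable bdd_fun_mult bdd_fun_NM bdd_fun_shift)

lemma integrable_N: "bdd_fun N f \<Longrightarrow> integrable M f"
  by (intro bdd_fun_integrable bdd_fun_NM)

lemma corr_add_left:
  assumes "bdd_fun N f" "bdd_fun N f'" "bdd_fun N g"
  shows "corr (\<lambda>\<omega>. f \<omega> + f' \<omega>) g = (\<lambda>t. corr f g t + corr f' g t)"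
  using integrable_corr[OF assms(1,3)] integrable_corr[OF assms(2,3)] integrable_N[OF assms(1)] integrable_N[OF assms(2)]
  by (auto simp: corr_def distrib_right intro!: ext)

lemma corr_add_right:
  assumes "bdd_fun N f" "bdd_fun N g" "bdd_fun N g'"
  shows "corr f (\<lambda>\<omega>. g \<omega> + g' \<omega>) = (\<lambda>t. corr f g t + corr f g' t)"
  using integrable_corr[OF assms(1,2)] integrable_corr[OF assms(1,3)] integrable_N[OF assms(2)] integrable_N[OF assms(3)]
  by (auto simp: corr_def distrib_left intro!: ext)

lemma corr_scale_left: "corr (\<lambda>\<omega>. c * f \<omega>) g = (\<lambda>t. c * corr f g t)"
  by (auto simp: corr_def mult.assoc right_diff_distrib intro!: ext)

lemma corr_scale_right: "corr f (\<lambda>\<omega>. c * g \<omega>) = (\<lambda>t. c * corr f g t)"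
  by (auto simp: corr_def mult.left_commute right_diff_distrib intro!: ext)

lemma abs_expectation_le:
  assumes "bdd_fun M f" "\<And>\<omega>. \<omega> \<in> space M \<Longrightarrow> \<bar>f \<omega>\<bar> \<le> K"
  shows "\<bar>\<integral>\<omega>. f \<omega> \<partial>M\<bar> \<le> K"
proof -
  have "\<bar>\<integral>\<omega>. f \<omega> \<partial>M\<bar> \<le> (\<integral>\<omega>. \<bar>f \<omega>\<bar> \<partial>M)" by (rule integral_abs_bound)
  also have "\<dots> \<le> (\<integral>\<omega>. K \<partial>M)" using assms by (intro integral_mono bdd_fun_integrable bdd_fun_abs) auto
  finally show ?thesis by (simp add: prob_space)
qed

text \<open>Measurability in \<open>t\<close> is that of an integral depending on a parameter, the
  integrand being jointly measurable.\<close>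

lemma bdd_meas_corr:
  assumes f: "bdd_fun N f" and g: "bdd_fun N g"
  shows "bdd_meas discr (corr f g)"
  unfolding bdd_meas_def
proof
  have [measurable]: "f \<in> borel_measurable M" using bdd_funD[OF bdd_fun_NM[OF f]] .
  have "(\<lambda>p. f (snd p) * g (case p of (t, \<omega>) \<Rightarrow> \<theta> t \<omega>)) \<in> borel_measurable (idx_space discr \<Otimes>\<^sub>M M)"
    using measurable_compose[OF theta_joint_measurable bdd_funD[OF g]] by (intro borel_measurable_times) auto
  then have "(\<lambda>t. \<integral>\<omega>. f \<omega> * g (\<theta> t \<omega>) \<partial>M) \<in> borel_measurable (idx_space discr)"
    by (intro borel_measurable_lebesgue_integral) (simp add: case_prod_beta)
  then have "(\<lambda>t. (\<integral>\<omega>. f \<omega> * g (\<theta> t \<omega>) \<partial>M) - (\<integral>\<omega>. f \<omega> \<partial>M) * (\<integral>\<omega>. g \<omega> \<partial>M)) \<in> borel_measurable (lam discr)"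
    by (intro measurable_idx_space_lam borel_measurable_diff) auto
  then show "corr f g \<in> borel_measurable (lam discr)"
    by (rule measurable_cong[THEN iffD1, rotated]) (simp add: corr_def)
  obtain K where K: "\<And>\<omega>. \<omega> \<in> space M \<Longrightarrow> \<bar>f \<omega>\<bar> \<le> K" using bdd_fun_NM[OF f] by (auto simp: bdd_fun_def)
  obtain L where L: "\<And>\<omega>. \<omega> \<in> space M \<Longrightarrow> \<bar>g \<omega>\<bar> \<le> L" using bdd_fun_NM[OF g] by (auto simp: bdd_fun_def)
  have "\<bar>corr f g t\<bar> \<le> \<bar>K\<bar> * \<bar>L\<bar> + \<bar>(\<integral>\<omega>. f \<omega> \<partial>M) * (\<integral>\<omega>. g \<omega> \<partial>M)\<bar>" if t: "t \<in> Tset discr" for t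
  proof -
    have "\<bar>\<integral>\<omega>. f \<omega> * g (\<theta> t \<omega>) \<partial>M\<bar> \<le> \<bar>K\<bar> * \<bar>L\<bar>"
    proof (rule abs_expectation_le)
      show "bdd_fun M (\<lambda>\<omega>. f \<omega> * g (\<theta> t \<omega>))" by (intro bdd_fun_mult bdd_fun_NM[OF f] bdd_fun_shift[OF g t])
      show "\<bar>f \<omega> * g (\<theta> t \<omega>)\<bar> \<le> \<bar>K\<bar> * \<bar>L\<bar>" if "\<omega> \<in> space M" for \<omega>
        unfolding abs_mult using K[OF that] L[OF theta_space[OF t that]] by (intro mult_mono) auto
    qed
    then show ?thesis using t unfolding corr_def by (auto intro: order_trans[OF abs_triangle_ineq4])
  qed
  then show "\<exists>K. \<forall>t\<in>Tset discr. \<bar>corr f g t\<bar> \<le> K" by blast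
qed

text \<open>Telescoping \<open>f g - f' g'\<close> as \<open>(f - f') g + f' (g - g')\<close>
  requires bounds for \<open>g\<close> and \<open>f'\<close> only. The estimate is uniform in
  \<open>t\<close> because the shift preserves the measure; the factor 2 accounts for the joint term
  and the product of the means.\<close>

lemma corr_diff_bound:
  assumes f: "bdd_fun N f" and f': "bdd_fun N f'" and g: "bdd_fun N g" and g': "bdd_fun N g'"
    and K: "\<And>\<omega>. \<omega> \<in> space M \<Longrightarrow> \<bar>f' \<omega>\<bar> \<le> K" and L: "\<And>\<omega>. \<omega> \<in> space M \<Longrightarrow> \<bar>g \<omega>\<bar> \<le> L"
    and t: "t \<in> Tset discr"
  shows "\<bar>corr f g t - corr f' g' t\<bar> \<le> 2 * (L * (\<integral>\<omega>. \<bar>f \<omega> - f' \<omega>\<bar> \<partial>M) + K * (\<integral>\<omega>. \<bar>g \<omega> - g' \<omega>\<bar> \<partial>M))"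
proof -
  note M = bdd_fun_NM[OF f] bdd_fun_NM[OF f'] bdd_fun_NM[OF g] bdd_fun_NM[OF g'] bdd_fun_shift[OF g t] bdd_fun_shift[OF g' t]
  let ?a = "\<integral>\<omega>. \<bar>f \<omega> - f' \<omega>\<bar> \<partial>M" and ?b = "\<integral>\<omega>. \<bar>g \<omega> - g' \<omega>\<bar> \<partial>M"
  have "bdd_fun N (\<lambda>\<omega>. \<bar>g \<omega> - g' \<omega>\<bar>)" by (intro bdd_fun_abs bdd_fun_diff g g')
  from expectation_shift[OF this t] have b_shift: "(\<integral>\<omega>. \<bar>g (\<theta> t \<omega>) - g' (\<theta> t \<omega>)\<bar> \<partial>M) = ?b" .
  have "(\<integral>\<omega>. f \<omega> * g (\<theta> t \<omega>) \<partial>M) - (\<integral>\<omega>. f' \<omega> * g' (\<theta> t \<omega>) \<partial>M)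
      = (\<integral>\<omega>. f \<omega> * g (\<theta> t \<omega>) - f' \<omega> * g' (\<theta> t \<omega>) \<partial>M)"
    by (rule Bochner_Integration.integral_diff[symmetric]) (intro bdd_fun_integrable bdd_fun_mult M)+
  also have "\<bar>\<dots>\<bar> \<le> (\<integral>\<omega>. \<bar>f \<omega> * g (\<theta> t \<omega>) - f' \<omega> * g' (\<theta> t \<omega>)\<bar> \<partial>M)" by (rule integral_abs_bound)
  also have "\<dots> \<le> (\<integral>\<omega>. L * \<bar>f \<omega> - f' \<omega>\<bar> + K * \<bar>g (\<theta> t \<omega>) - g' (\<theta> t \<omega>)\<bar> \<partial>M)"
  proof (intro integral_mono bdd_fun_integrable bdd_fun_abs bdd_fun_add bdd_fun_diff bdd_fun_mult bdd_fun_const M)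
    fix \<omega> assume w: "\<omega> \<in> space M"
    have "f \<omega> * g (\<theta> t \<omega>) - f' \<omega> * g' (\<theta> t \<omega>)
        = (f \<omega> - f' \<omega>) * g (\<theta> t \<omega>) + f' \<omega> * (g (\<theta> t \<omega>) - g' (\<theta> t \<omega>))" by (simp add: algebra_simps)
    also have "\<bar>\<dots>\<bar> \<le> \<bar>f \<omega> - f' \<omega>\<bar> * \<bar>g (\<theta> t \<omega>)\<bar> + \<bar>f' \<omega>\<bar> * \<bar>g (\<theta> t \<omega>) - g' (\<theta> t \<omega>)\<bar>"
      by (metis abs_mult abs_triangle_ineq)
    also have "\<dots> \<le> \<bar>f \<omega> - f' \<omega>\<bar> * L + K * \<bar>g (\<theta> t \<omega>) - g' (\<theta> t \<omega>)\<bar>"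
      using K[OF w] L[OF theta_space[OF t w]] by (intro add_mono mult_left_mono mult_right_mono) auto
    finally show "\<bar>f \<omega> * g (\<theta> t \<omega>) - f' \<omega> * g' (\<theta> t \<omega>)\<bar>
        \<le> L * \<bar>f \<omega> - f' \<omega>\<bar> + K * \<bar>g (\<theta> t \<omega>) - g' (\<theta> t \<omega>)\<bar>" by (simp add: mult.commute)
  qed
  also have "\<dots> = (\<integral>\<omega>. L * \<bar>f \<omega> - f' \<omega>\<bar> \<partial>M) + (\<integral>\<omega>. K * \<bar>g (\<theta> t \<omega>) - g' (\<theta> t \<omega>)\<bar> \<partial>M)"
    by (rule Bochner_Integration.integral_add)
      (intro bdd_fun_integrable bdd_fun_abs bdd_fun_diff bdd_fun_mult bdd_fun_const M)+
  also have "\<dots> = L * ?a + K * ?b" by (simp add: b_shift)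
  finally have 1: "\<bar>(\<integral>\<omega>. f \<omega> * g (\<theta> t \<omega>) \<partial>M) - (\<integral>\<omega>. f' \<omega> * g' (\<theta> t \<omega>) \<partial>M)\<bar> \<le> L * ?a + K * ?b" .
  have diff: "\<bar>(\<integral>\<omega>. h \<omega> \<partial>M) - (\<integral>\<omega>. h' \<omega> \<partial>M)\<bar> \<le> (\<integral>\<omega>. \<bar>h \<omega> - h' \<omega>\<bar> \<partial>M)"
    if "bdd_fun M h" "bdd_fun M h'" for h h'
    using integral_abs_bound[of M "\<lambda>\<omega>. h \<omega> - h' \<omega>"] bdd_fun_integrable[OF that(1)] bdd_fun_integrable[OF that(2)]
    by simp
  have "(\<integral>\<omega>. f \<omega> \<partial>M) * (\<integral>\<omega>. g \<omega> \<partial>M) - (\<integral>\<omega>. f' \<omega> \<partial>M) * (\<integral>\<omega>. g' \<omega> \<partial>M)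
      = ((\<integral>\<omega>. f \<omega> \<partial>M) - (\<integral>\<omega>. f' \<omega> \<partial>M)) * (\<integral>\<omega>. g \<omega> \<partial>M) + (\<integral>\<omega>. f' \<omega> \<partial>M) * ((\<integral>\<omega>. g \<omega> \<partial>M) - (\<integral>\<omega>. g' \<omega> \<partial>M))"
    by (simp add: algebra_simps)
  also have "\<bar>\<dots>\<bar> \<le> \<bar>(\<integral>\<omega>. f \<omega> \<partial>M) - (\<integral>\<omega>. f' \<omega> \<partial>M)\<bar> * \<bar>\<integral>\<omega>. g \<omega> \<partial>M\<bar> + \<bar>\<integral>\<omega>. f' \<omega> \<partial>M\<bar> * \<bar>(\<integral>\<omega>. g \<omega> \<partial>M) - (\<integral>\<omega>. g' \<omega> \<partial>M)\<bar>"
    by (metis abs_mult abs_triangle_ineq)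
  also have "\<dots> \<le> ?a * L + K * ?b"
    using diff[OF M(1,2)] diff[OF M(3,4)] abs_expectation_le[OF M(3) L] abs_expectation_le[OF M(2) K]
    by (intro add_mono mult_mono) auto
  finally have 2: "\<bar>(\<integral>\<omega>. f \<omega> \<partial>M) * (\<integral>\<omega>. g \<omega> \<partial>M) - (\<integral>\<omega>. f' \<omega> \<partial>M) * (\<integral>\<omega>. g' \<omega> \<partial>M)\<bar> \<le> L * ?a + K * ?b"
    by (simp add: mult.commute)
  show ?thesis using 1 2 t unfolding corr_def by (auto simp: abs_le_iff)
qed

text \<open>\<open>Q\<close> is abstract so that the same bilinear extension serves twice: for
  \<open>mean_zero\<close> from indicators to bounded functions, and for \<open>cesaro_null\<close>
  from cosines back to indicators.\<close>

lemma corr_extend: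
  assumes Q_add: "\<And>q r. Q q \<Longrightarrow> Q r \<Longrightarrow> Q (\<lambda>t. q t + r t)" and Q_scale: "\<And>c q. Q q \<Longrightarrow> Q (\<lambda>t. c * q t)"
    and Q_limit: "\<And>q. bdd_meas discr q \<Longrightarrow>
      (\<And>\<epsilon>. \<epsilon> > 0 \<Longrightarrow> \<exists>r. Q r \<and> (\<forall>t\<in>Tset discr. \<bar>q t - r t\<bar> \<le> \<epsilon>)) \<Longrightarrow> Q q"
    and G: "\<And>g. g \<in> G \<Longrightarrow> bdd_fun N g" "\<And>g h. g \<in> G \<Longrightarrow> h \<in> G \<Longrightarrow> Q (corr g h)"
    and f: "bdd_fun N f" "f \<in> L1_closure M G" and g: "bdd_fun N g" "g \<in> L1_closure M G"
  shows "Q (corr f g)"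
proof (rule Q_limit[OF bdd_meas_corr[OF f(1) g(1)]])
  have bdd: "bdd_fun N p" if "p \<in> fspan G" for p using that G(1) by (rule bdd_fun_fspan)
  have step: "Q (corr p h)" if "p \<in> fspan G" "h \<in> G" for p h
    using that(1)
  proof induction
    case (add p q)
    then show ?case using corr_add_left[OF bdd bdd G(1)[OF that(2)]] Q_add by simp
  next
    case (scale p c)
    then show ?case using corr_scale_left Q_scale by simp
  qed (use G that in auto)
  have span: "Q (corr p q)" if p: "p \<in> fspan G" and "q \<in> fspan G" for p q
    using that(2)
  proof induction
    case (add q r)
    then show ?case using corr_add_right[OF bdd[OF p] bdd bdd] Q_add by simp
  next
    case (scale q c)
    then show ?case using corr_scale_right Q_scale by simp
  qed (use step p in auto)
  fix \<epsilon> :: real assume e: "\<epsilon> > 0"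
  obtain L0 where L0: "\<And>\<omega>. \<omega> \<in> space M \<Longrightarrow> \<bar>g \<omega>\<bar> \<le> L0" using bdd_fun_NM[OF g(1)] by (auto simp: bdd_fun_def)
  define L where "L = \<bar>L0\<bar> + 1"
  have L: "L > 0" "\<And>\<omega>. \<omega> \<in> space M \<Longrightarrow> \<bar>g \<omega>\<bar> \<le> L" using L0 by (fastforce simp: L_def)+
  \<comment> \<open>The accuracy for \<open>f\<close> depends on the bound of \<open>g\<close>, and
    the accuracy for \<open>g\<close> on the bound of the chosen \<open>p\<close>; hence
    \<open>p\<close> is fixed before \<open>q\<close>. The two errors add up to
    \<open>2 * (\<epsilon> / 4 + \<epsilon> / 4)\<close>.\<close>
  have "\<epsilon> / (4 * L) > 0" using e L(1) by simp
  then obtain p where p: "p \<in> fspan G" "(\<integral>\<omega>. \<bar>f \<omega> - p \<omega>\<bar> \<partial>M) < \<epsilon> / (4 * L)"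
    using f(2) unfolding L1_closure_def by blast
  obtain K0 where K0: "\<And>\<omega>. \<omega> \<in> space M \<Longrightarrow> \<bar>p \<omega>\<bar> \<le> K0" using bdd_fun_NM[OF bdd[OF p(1)]] by (auto simp: bdd_fun_def)
  define K where "K = \<bar>K0\<bar> + 1"
  have K: "K > 0" "\<And>\<omega>. \<omega> \<in> space M \<Longrightarrow> \<bar>p \<omega>\<bar> \<le> K" using K0 by (fastforce simp: K_def)+
  have "\<epsilon> / (4 * K) > 0" using e K(1) by simp
  then obtain q where q: "q \<in> fspan G" "(\<integral>\<omega>. \<bar>g \<omega> - q \<omega>\<bar> \<partial>M) < \<epsilon> / (4 * K)"
    using g(2) unfolding L1_closure_def by blast
  have "L * (\<integral>\<omega>. \<bar>f \<omega> - p \<omega>\<bar> \<partial>M) \<le> \<epsilon> / 4" "K * (\<integral>\<omega>. \<bar>g \<omega> - q \<omega>\<bar> \<partial>M) \<le> \<epsilon> / 4"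
    using p(2) q(2) K(1) L(1) by (simp_all add: field_simps)
  then have "\<bar>corr f g t - corr p q t\<bar> \<le> \<epsilon>" if "t \<in> Tset discr" for t
    using corr_diff_bound[OF f(1) bdd[OF p(1)] g(1) bdd[OF q(1)] K(2) L(2) that] by simp
  then show "\<exists>r. Q r \<and> (\<forall>t\<in>Tset discr. \<bar>corr f g t - r t\<bar> \<le> \<epsilon>)" using span[OF p(1) q(1)] by blast
qed

lemma corr_indicator:
  assumes A: "A \<in> sets N" and B: "B \<in> sets N" and t: "t \<in> Tset discr"
  shows "corr (indicator A) (indicator B) t = measure M (A \<inter> (\<theta> t -` B \<inter> space M)) - measure M A * measure M B"
proof -
  have M: "A \<in> sets M" "B \<in> sets M" using A B sets_N_subset by auto
  have "(\<integral>\<omega>. indicat_real A \<omega> * indicat_real B (\<theta> t \<omega>) \<partial>M) = (\<integral>\<omega>. indicat_real (A \<inter> (\<theta> t -` B \<inter> space M)) \<omega> \<partial>M)"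
    by (intro Bochner_Integration.integral_cong) (auto simp: indicator_def)
  also have "\<dots> = measure M (A \<inter> (\<theta> t -` B \<inter> space M))"
    using M measurable_sets[OF theta_measurable[OF t] M(2)] by simp
  finally show ?thesis using t M by (simp add: corr_def)
qed

lemma avg_corr_indicator:
  assumes A: "A \<in> sets N" and B: "B \<in> sets N" and T: "T > 0"
  shows "avg discr T (\<lambda>t. measure M (A \<inter> (\<theta> t -` B \<inter> space M)))
    = avg discr T (corr (indicator A) (indicator B)) + avg discr T (\<lambda>t::real^'d. measure M A * measure M B)"
proof -
  have "avg discr T (\<lambda>t. measure M (A \<inter> (\<theta> t -` B \<inter> space M)))
      = avg discr T (\<lambda>t. corr (indicator A) (indicator B) t + measure M A * measure M B)"
    unfolding avg_def using Bbox_subset[of discr T]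
    by (intro arg_cong2[of _ _ _ _ "(*)"] refl set_lebesgue_integral_cong) (auto simp: corr_indicator[OF A B])
  then show ?thesis using A B T by (simp add: avg_add bdd_meas_corr bdd_fun_indicator)
qed

section \<open>Ergodicity and weak mixing in terms of covariances\<close>

lemma ergodic_iff_mean_zero:
  "ergodic_action discr M \<theta> X \<longleftrightarrow>
    (\<forall>A\<in>sets N. \<forall>B\<in>sets N. mean_zero discr (corr (indicator A) (indicator B)))"
proof -
  have "((\<lambda>T. avg discr T (\<lambda>t. measure M (A \<inter> (\<theta> t -` B \<inter> space M)))) \<longlongrightarrow> measure M A * measure M B) at_top
      \<longleftrightarrow> mean_zero discr (corr (indicator A) (indicator B))" if A: "A \<in> sets N" and B: "B \<in> sets N" for A B
  proof -
    let ?m = "\<lambda>T. avg discr T (\<lambda>t. measure M (A \<inter> (\<theta> t -` B \<inter> space M)))"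
    let ?c = "\<lambda>T. avg discr T (\<lambda>t::real^'d. measure M A * measure M B)"
    have eq: "\<forall>\<^sub>F T in at_top. avg discr T (corr (indicator A) (indicator B)) = ?m T - ?c T"
      using eventually_gt_at_top[of 0] by eventually_elim (simp add: avg_corr_indicator[OF A B])
    have c: "(?c \<longlongrightarrow> measure M A * measure M B) at_top" by (rule avg_const_tendsto)
    have "mean_zero discr (corr (indicator A) (indicator B)) \<longleftrightarrow> ((\<lambda>T. ?m T - ?c T) \<longlongrightarrow> 0) at_top"
      using A B tendsto_cong[OF eq] by (simp add: mean_zero_def bdd_meas_corr bdd_fun_indicator)
    also have "\<dots> \<longleftrightarrow> (?m \<longlongrightarrow> measure M A * measure M B) at_top"
    proof
      assume "((\<lambda>T. ?m T - ?c T) \<longlongrightarrow> 0) at_top"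
      from tendsto_add[OF this c] show "(?m \<longlongrightarrow> measure M A * measure M B) at_top" by simp
    next
      assume "(?m \<longlongrightarrow> measure M A * measure M B) at_top"
      from tendsto_diff[OF this c] show "((\<lambda>T. ?m T - ?c T) \<longlongrightarrow> 0) at_top" by simp
    qed
    finally show ?thesis ..
  qed
  then show ?thesis unfolding ergodic_action_def sets_N[symmetric] avg_def[symmetric] by simp
qed

lemma ergodic_mean_zero_bdd:
  assumes erg: "ergodic_action discr M \<theta> X" and f: "bdd_fun N f" and g: "bdd_fun N g"
  shows "mean_zero discr (corr f g)"
proof (rule corr_extend[where G="{indicator A | A. A \<in> sets N}"])
  show "bdd_fun N h" if "h \<in> {indicator A | A. A \<in> sets N}" for h using that by (auto intro: bdd_fun_indicator)
  show "mean_zero discr (corr h k)" if "h \<in> {indicator A | A. A \<in> sets N}" "k \<in> {indicator A | A. A \<in> sets N}" for h k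
    using that erg by (auto simp: ergodic_iff_mean_zero)
  show "f \<in> L1_closure M {indicator A | A. A \<in> sets N}" "g \<in> L1_closure M {indicator A | A. A \<in> sets N}"
    by (intro bdd_fun_in_L1_closure_indicators space_N sets_N_subset f g)+
qed (use f g in \<open>auto intro: mean_zero_add mean_zero_cmult mean_zero_uniform_limit\<close>)

text \<open>Convergence along all sequences in \<open>D\<close> that tend to infinity forces uniform
  smallness on \<open>D\<close> far out, as otherwise a sequence of bad points would contradict it.
  Bounded covariances that are small in this sense have vanishing absolute averages, hence vanishing
  signed ones.\<close>

lemma weakly_mixing_imp_ergodic:
  assumes "weakly_mixing_action discr M \<theta> X"
  shows "ergodic_action discr M \<theta> X"
  unfolding ergodic_iff_mean_zero
proof (intro ballI)
  fix A B assume A: "A \<in> sets N" and B: "B \<in> sets N"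
  obtain D where D: "density_one discr D" and lim: "\<And>tn. (\<And>n::nat. tn n \<in> D) \<Longrightarrow>
      filterlim (\<lambda>n. maxnorm (tn n)) at_top sequentially \<Longrightarrow>
      (\<lambda>n. measure M (A \<inter> (\<theta> (tn n) -` B \<inter> space M))) \<longlonglongrightarrow> measure M A * measure M B"
    using assms A B unfolding weakly_mixing_action_def sets_N[symmetric] by blast
  have DT: "D \<subseteq> Tset discr" using D by (simp add: density_one_def)
  have "cesaro_null discr (corr (indicator A) (indicator B))"
  proof (rule cesaro_null_if_vanishes_on_density_one[OF _ D])
    show "bdd_meas discr (corr (indicator A) (indicator B))" by (intro bdd_meas_corr bdd_fun_indicator A B)
    fix \<epsilon> :: real assume "\<epsilon> > 0"
    show "\<exists>R. \<forall>t\<in>D. R \<le> maxnorm t \<longrightarrow> \<bar>corr (indicator A) (indicator B) t\<bar> < \<epsilon>"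
    proof (rule ccontr)
      assume "\<not> ?thesis"
      then have "\<forall>n. \<exists>t. t \<in> D \<and> real n \<le> maxnorm t \<and> \<epsilon> \<le> \<bar>corr (indicator A) (indicator B) t\<bar>"
        by (meson not_less)
      then obtain tn where tn: "\<And>n. tn n \<in> D" "\<And>n. real n \<le> maxnorm (tn n)"
        "\<And>n. \<epsilon> \<le> \<bar>corr (indicator A) (indicator B) (tn n)\<bar>" by metis
      have "filterlim (\<lambda>n. maxnorm (tn n)) at_top sequentially"
        by (rule filterlim_at_top_mono[OF filterlim_real_sequentially]) (simp add: tn(2))
      from tendsto_diff[OF lim[OF tn(1) this] tendsto_const[of "measure M A * measure M B"]]
      have "(\<lambda>n. corr (indicator A) (indicator B) (tn n)) \<longlonglongrightarrow> 0"
        using corr_indicator[OF A B] tn(1) DT by (simp add: subset_iff)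
      from tendstoD[OF this \<open>\<epsilon> > 0\<close>] show False
        using tn(3) by (auto simp: eventually_sequentially not_less[symmetric])
    qed
  qed
  then show "mean_zero discr (corr (indicator A) (indicator B))" by (rule cesaro_null_imp_mean_zero)
qed

text \<open>The countable family \<open>C\<close> from joint measurability may contain events
  outside \<open>sigmaX\<close>, which is why separability is inherited through the metric and the
  dense sequence is chosen inside \<open>sets N\<close>.\<close>

lemma sigmaX_separable:
  "\<exists>A :: nat \<Rightarrow> 'a set. range A \<subseteq> sets N \<and> (\<forall>B\<in>sets N. \<forall>\<epsilon>>0. \<exists>n. measure M ((B - A n) \<union> (A n - B)) < \<epsilon>)"
proof -
  obtain C where C: "countable C" "C \<subseteq> sets M"
    and meas: "(\<lambda>(t, \<omega>). X t \<omega>) \<in> borel_measurable (idx_space discr \<Otimes>\<^sub>M sigma (space M) C)"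
    using pair_measurable_countably_generated[OF X_joint] by blast
  have CP: "C \<subseteq> Pow (space M)" using C(2) sets.space_closed[of M] by (rule order_trans)
  have "X t -` A \<inter> space M \<in> sigma_sets (space M) C" if "t \<in> Tset discr" "A \<in> sets borel" for t A
  proof -
    have "X t \<in> borel_measurable (sigma (space M) C)"
      using measurable_Pair2[OF meas, of t] that(1) by simp
    from measurable_sets[OF this that(2)] show ?thesis using CP by simp
  qed
  then have "sets N \<subseteq> sigma_sets (space M) C"
    unfolding sets_N_eq by (intro sigma_sets_mono) (auto simp: gens_def)
  then show ?thesis by (intro countably_generated_subset_separable[OF C]) auto
qed

text \<open>\<open>D\<close> is fixed by the pairs from a countable dense family of events.
  Replacing arbitrary \<open>A\<close>, \<open>B\<close> by nearby members changes the covariance by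
  an amount that is small uniformly in \<open>t\<close>, so the same \<open>D\<close> works for all
  pairs.\<close>

lemma cesaro_null_imp_weakly_mixing:
  assumes null: "\<And>A B. A \<in> sets N \<Longrightarrow> B \<in> sets N \<Longrightarrow> cesaro_null discr (corr (indicator A) (indicator B))"
  shows "weakly_mixing_action discr M \<theta> X"
proof -
  obtain S :: "nat \<Rightarrow> 'a set" where S: "\<And>n. S n \<in> sets N"
    and dense: "\<And>B \<epsilon>. B \<in> sets N \<Longrightarrow> \<epsilon> > 0 \<Longrightarrow> \<exists>n. measure M ((B - S n) \<union> (S n - B)) < \<epsilon>"
    using sigmaX_separable by (metis rangeI subsetD)
  define q where "q k = (case prod_decode k of (i, j) \<Rightarrow> corr (indicator (S i)) (indicator (S j)))" for k
  have "\<exists>D. density_one discr D \<and> (\<forall>k. \<forall>\<epsilon>>0. \<exists>R. \<forall>t\<in>D. R \<le> maxnorm t \<longrightarrow> \<bar>q k t\<bar> < \<epsilon>)"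
  proof (rule cesaro_null_family_vanishes_on_density_one)
    show "cesaro_null discr (q k)" for k unfolding q_def by (simp add: case_prod_beta null S)
    fix k and t :: "real^'d" assume t: "t \<in> Tset discr"
    have "\<bar>measure M U - measure M V * measure M W\<bar> \<le> 1" for U V W
    proof -
      have "measure M V * measure M W \<le> 1" by (intro mult_le_one) auto
      moreover have "0 \<le> measure M V * measure M W" by simp
      ultimately show ?thesis using measure_nonneg[of M U] prob_le_1[of U] by linarith
    qed
    then show "\<bar>q k t\<bar> \<le> 1" unfolding q_def by (simp add: case_prod_beta corr_indicator[OF S S t])
  qed
  then obtain D where D: "density_one discr D"
    and lim: "\<And>k \<epsilon>. \<epsilon> > 0 \<Longrightarrow> \<exists>R. \<forall>t\<in>D. R \<le> maxnorm t \<longrightarrow> \<bar>q k t\<bar> < \<epsilon>" by blast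
  have DT: "D \<subseteq> Tset discr" using D by (simp add: density_one_def)
  have L1: "(\<integral>\<omega>. \<bar>indicat_real A \<omega> - indicator B \<omega>\<bar> \<partial>M) = measure M ((A - B) \<union> (B - A))"
    if "A \<in> sets N" "B \<in> sets N" for A B
  proof -
    have "(\<integral>\<omega>. \<bar>indicat_real A \<omega> - indicator B \<omega>\<bar> \<partial>M) = (\<integral>\<omega>. indicat_real ((A - B) \<union> (B - A)) \<omega> \<partial>M)"
      by (intro Bochner_Integration.integral_cong) (auto simp: indicator_def)
    moreover have "A \<in> sets M" "B \<in> sets M" using that sets_N_subset by auto
    then have "(\<integral>\<omega>. indicat_real ((A - B) \<union> (B - A)) \<omega> \<partial>M) = measure M ((A - B) \<union> (B - A))" by simp
    ultimately show ?thesis by simp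
  qed
  have "(\<lambda>n. measure M (A \<inter> (\<theta> (tn n) -` B \<inter> space M))) \<longlonglongrightarrow> measure M A * measure M B"
    if A: "A \<in> sets N" and B: "B \<in> sets N" and tn: "\<And>n. tn n \<in> D"
      and inf: "filterlim (\<lambda>n. maxnorm (tn n)) at_top sequentially" for A B and tn :: "nat \<Rightarrow> real^'d"
  proof (rule tendstoI)
    fix \<epsilon> :: real assume e: "\<epsilon> > 0"
    \<comment> \<open>With \<open>\<epsilon> / 8\<close> on each side the replacement costs less
      than \<open>2 * (\<epsilon> / 8 + \<epsilon> / 8) = \<epsilon> / 2\<close>.\<close>
    obtain i where i: "measure M ((A - S i) \<union> (S i - A)) < \<epsilon> / 8" using dense[OF A, of "\<epsilon> / 8"] e by auto
    obtain j where j: "measure M ((B - S j) \<union> (S j - B)) < \<epsilon> / 8" using dense[OF B, of "\<epsilon> / 8"] e by auto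
    obtain R where R: "\<And>t. t \<in> D \<Longrightarrow> R \<le> maxnorm t \<Longrightarrow> \<bar>q (prod_encode (i, j)) t\<bar> < \<epsilon> / 2"
      using lim[of "\<epsilon> / 2" "prod_encode (i, j)"] e by auto
    have "\<forall>\<^sub>F n in sequentially. R \<le> maxnorm (tn n)" using inf by (simp add: filterlim_at_top)
    then show "\<forall>\<^sub>F n in sequentially. dist (measure M (A \<inter> (\<theta> (tn n) -` B \<inter> space M))) (measure M A * measure M B) < \<epsilon>"
    proof eventually_elim
      case (elim n)
      have t: "tn n \<in> Tset discr" using tn DT by auto
      have "\<bar>corr (indicator A) (indicator B) (tn n) - corr (indicator (S i)) (indicator (S j)) (tn n)\<bar>
          \<le> 2 * (1 * (\<integral>\<omega>. \<bar>indicat_real A \<omega> - indicator (S i) \<omega>\<bar> \<partial>M) + 1 * (\<integral>\<omega>. \<bar>indicat_real B \<omega> - indicator (S j) \<omega>\<bar> \<partial>M))"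
        by (rule corr_diff_bound[OF _ _ _ _ _ _ t]) (auto intro: bdd_fun_indicator A B S simp: indicator_def)
      also have "\<dots> < \<epsilon> / 2" using i j by (simp add: L1 A B S)
      finally have "\<bar>corr (indicator A) (indicator B) (tn n)\<bar> < \<epsilon>"
        using R[OF tn elim] unfolding q_def prod_encode_inverse case_prod_conv by linarith
      then show ?case by (simp add: dist_real_def corr_indicator[OF A B t])
    qed
  qed
  with D show ?thesis unfolding weakly_mixing_action_def sets_N[symmetric] by blast
qed

end

section \<open>Stable fields\<close>

text \<open>The characteristic function is real, so its sine part vanishes. The factor
  \<open>2 powr (1 / \<alpha>)\<close> is chosen to double the exponent
  \<open>(\<sigma> * \<bar>u\<bar>) powr \<alpha>\<close>, that is, to square the characteristic
  function.\<close>

lemma SaS_rv_expectations: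
  assumes M: "prob_space M" and Y: "Y \<in> borel_measurable M" and \<alpha>: "\<alpha> > 0" and SaS: "SaS_rv \<alpha> M Y"
  shows "(\<integral>\<omega>. sin (Y \<omega>) \<partial>M) = 0"
    and "(\<integral>\<omega>. cos (2 powr (1 / \<alpha>) * Y \<omega>) \<partial>M) = (\<integral>\<omega>. cos (Y \<omega>) \<partial>M)\<^sup>2"
proof -
  interpret prob_space M by (rule M)
  obtain \<sigma> where \<sigma>: "\<sigma> \<ge> 0" and char: "\<And>u. char (distr M borel Y) u = complex_of_real (exp (- ((\<sigma> * \<bar>u\<bar>) powr \<alpha>)))"
    using SaS unfolding SaS_rv_def by blast
  have char_eq: "char (distr M borel Y) u = (\<integral>\<omega>. iexp (u * Y \<omega>) \<partial>M)" for u
    unfolding char_def by (subst integral_distr) (use Y in auto)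
  have int: "integrable M (\<lambda>\<omega>. iexp (u * Y \<omega>))" for u
    using Y by (intro integrable_const_bound[where B=1]) auto
  have cos_eq: "(\<integral>\<omega>. cos (u * Y \<omega>) \<partial>M) = exp (- ((\<sigma> * \<bar>u\<bar>) powr \<alpha>))" for u
  proof -
    have "(\<integral>\<omega>. cos (u * Y \<omega>) \<partial>M) = (\<integral>\<omega>. Re (iexp (u * Y \<omega>)) \<partial>M)" by (simp add: Re_exp)
    also have "\<dots> = Re (\<integral>\<omega>. iexp (u * Y \<omega>) \<partial>M)" by (rule integral_Re[OF int])
    finally show ?thesis using char[of u] by (simp add: char_eq)
  qed
  have sin_eq: "(\<integral>\<omega>. sin (u * Y \<omega>) \<partial>M) = 0" for u
  proof -
    have "(\<integral>\<omega>. sin (u * Y \<omega>) \<partial>M) = (\<integral>\<omega>. Im (iexp (u * Y \<omega>)) \<partial>M)" by (simp add: Im_exp)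
    also have "\<dots> = Im (\<integral>\<omega>. iexp (u * Y \<omega>) \<partial>M)" by (rule integral_Im[OF int])
    finally show ?thesis using char[of u] by (simp add: char_eq)
  qed
  show "(\<integral>\<omega>. sin (Y \<omega>) \<partial>M) = 0" using sin_eq[of 1] by simp
  have "(\<sigma> * \<bar>2 powr (1 / \<alpha>)\<bar>) powr \<alpha> = \<sigma> powr \<alpha> * 2"
    using \<sigma> \<alpha> by (simp add: powr_mult powr_powr)
  then show "(\<integral>\<omega>. cos (2 powr (1 / \<alpha>) * Y \<omega>) \<partial>M) = (\<integral>\<omega>. cos (Y \<omega>) \<partial>M)\<^sup>2"
    using cos_eq[of "2 powr (1 / \<alpha>)"] cos_eq[of 1] by (simp add: power2_eq_square flip: exp_add)
qed

locale SaS_stationary_field = stationary_field M discr \<theta> X0 X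
  for M :: "'a measure" and discr and \<theta> :: "real^'d \<Rightarrow> 'a \<Rightarrow> 'a" and X0 X +
  fixes \<alpha> :: real
  assumes alpha_pos: "0 < \<alpha>" and SaS: "SaS_field discr \<alpha> M X"
begin

section \<open>The linear span of the field\<close>

text \<open>Equality is asked only on \<open>space M\<close>, because the action law that drives
  \<open>lincombs_shift\<close> is available only there.\<close>

definition lincombs :: "('a \<Rightarrow> real) set" where
  "lincombs = {Y. \<exists>F c. finite F \<and> F \<subseteq> Tset discr \<and> (\<forall>\<omega>\<in>space M. Y \<omega> = (\<Sum>t\<in>F. c t * X t \<omega>))}"

lemma lincombsI:
  "finite F \<Longrightarrow> F \<subseteq> Tset discr \<Longrightarrow> (\<And>\<omega>. \<omega> \<in> space M \<Longrightarrow> Y \<omega> = (\<Sum>t\<in>F. c t * X t \<omega>)) \<Longrightarrow> Y \<in> lincombs"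
  unfolding lincombs_def by blast

lemma X_lincombs: "t \<in> Tset discr \<Longrightarrow> X t \<in> lincombs"
  by (rule lincombsI[of "{t}" _ "\<lambda>_. 1"]) auto

lemma lincombs_scale:
  assumes "Y \<in> lincombs" shows "(\<lambda>\<omega>. a * Y \<omega>) \<in> lincombs"
proof -
  obtain F c where F: "finite F" "F \<subseteq> Tset discr" "\<And>\<omega>. \<omega> \<in> space M \<Longrightarrow> Y \<omega> = (\<Sum>t\<in>F. c t * X t \<omega>)"
    using assms unfolding lincombs_def by blast
  show ?thesis
    by (rule lincombsI[OF F(1,2), of _ "\<lambda>t. a * c t"]) (simp add: F(3) sum_distrib_left mult.assoc)
qed

lemma lincombs_add:
  assumes "Y \<in> lincombs" "Z \<in> lincombs" shows "(\<lambda>\<omega>. Y \<omega> + Z \<omega>) \<in> lincombs"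
proof -
  obtain F c where F: "finite F" "F \<subseteq> Tset discr" "\<And>\<omega>. \<omega> \<in> space M \<Longrightarrow> Y \<omega> = (\<Sum>t\<in>F. c t * X t \<omega>)"
    using assms(1) unfolding lincombs_def by blast
  obtain F' c' where F': "finite F'" "F' \<subseteq> Tset discr" "\<And>\<omega>. \<omega> \<in> space M \<Longrightarrow> Z \<omega> = (\<Sum>t\<in>F'. c' t * X t \<omega>)"
    using assms(2) unfolding lincombs_def by blast
  show ?thesis
  proof (rule lincombsI[of "F \<union> F'" _ "\<lambda>t. (if t \<in> F then c t else 0) + (if t \<in> F' then c' t else 0)"])
    fix \<omega> assume w: "\<omega> \<in> space M"
    have "(\<Sum>t\<in>F. c t * X t \<omega>) = (\<Sum>t\<in>F \<union> F'. (if t \<in> F then c t else 0) * X t \<omega>)"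
      using F(1) F'(1) by (intro sum.mono_neutral_cong_left) auto
    moreover have "(\<Sum>t\<in>F'. c' t * X t \<omega>) = (\<Sum>t\<in>F \<union> F'. (if t \<in> F' then c' t else 0) * X t \<omega>)"
      using F(1) F'(1) by (intro sum.mono_neutral_cong_left) auto
    ultimately show "Y \<omega> + Z \<omega> =
        (\<Sum>t\<in>F \<union> F'. ((if t \<in> F then c t else 0) + (if t \<in> F' then c' t else 0)) * X t \<omega>)"
      using F(3)[OF w] F'(3)[OF w] by (simp add: distrib_right sum.distrib)
  qed (use F F' in auto)
qed

text \<open>Shifting translates the index set of the combination. Consequently \<open>Y\<close> plus
  a shifted \<open>Z\<close> is again a combination of the field, which is how joint stability of
  the field is brought to bear.\<close>

lemma lincombs_shift:
  assumes "Y \<in> lincombs" and t: "t \<in> Tset discr" shows "(\<lambda>\<omega>. Y (\<theta> t \<omega>)) \<in> lincombs"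
proof -
  obtain F c where F: "finite F" "F \<subseteq> Tset discr" "\<And>\<omega>. \<omega> \<in> space M \<Longrightarrow> Y \<omega> = (\<Sum>t\<in>F. c t * X t \<omega>)"
    using assms(1) unfolding lincombs_def by blast
  show ?thesis
  proof (rule lincombsI[of "(\<lambda>s. s + t) ` F" _ "\<lambda>u. c (u - t)"])
    show "(\<lambda>s. s + t) ` F \<subseteq> Tset discr" using F(2) Tset_add t by blast
    fix \<omega> assume w: "\<omega> \<in> space M"
    have "Y (\<theta> t \<omega>) = (\<Sum>s\<in>F. c s * X s (\<theta> t \<omega>))" by (rule F(3)[OF theta_space[OF t w]])
    also have "\<dots> = (\<Sum>s\<in>F. c s * X (s + t) \<omega>)"
      using F(2) by (intro sum.cong refl) (auto simp: X_shift t w)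
    also have "\<dots> = (\<Sum>u\<in>(\<lambda>s. s + t) ` F. c (u - t) * X u \<omega>)"
      by (subst sum.reindex) (auto simp: inj_on_def)
    finally show "Y (\<theta> t \<omega>) = (\<Sum>u\<in>(\<lambda>s. s + t) ` F. c (u - t) * X u \<omega>)" .
  qed (use F in auto)
qed

lemma lincombs_measurable_N:
  assumes "Y \<in> lincombs" shows "Y \<in> borel_measurable N"
proof -
  obtain F c where F: "finite F" "F \<subseteq> Tset discr" "\<And>\<omega>. \<omega> \<in> space M \<Longrightarrow> Y \<omega> = (\<Sum>t\<in>F. c t * X t \<omega>)"
    using assms unfolding lincombs_def by blast
  have "(\<lambda>\<omega>. \<Sum>t\<in>F. c t * X t \<omega>) \<in> borel_measurable N"
    using F(2) by (intro borel_measurable_sum borel_measurable_times X_measurable_N) auto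
  then show ?thesis by (rule measurable_cong[THEN iffD1, rotated]) (simp add: F(3))
qed

lemma lincombs_measurable: "Y \<in> lincombs \<Longrightarrow> Y \<in> borel_measurable M"
  using lincombs_measurable_N measurable_mono[of borel borel N M] sets_N_subset by auto

lemma lincombs_SaS:
  assumes "Y \<in> lincombs" shows "SaS_rv \<alpha> M Y"
proof -
  obtain F c where F: "finite F" "F \<subseteq> Tset discr" "\<And>\<omega>. \<omega> \<in> space M \<Longrightarrow> Y \<omega> = (\<Sum>t\<in>F. c t * X t \<omega>)"
    using assms unfolding lincombs_def by blast
  have "SaS_rv \<alpha> M (\<lambda>\<omega>. \<Sum>t\<in>F. c t * X t \<omega>)" using SaS F(1,2) unfolding SaS_field_def by blast
  moreover have "distr M borel (\<lambda>\<omega>. \<Sum>t\<in>F. c t * X t \<omega>) = distr M borel Y"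
    by (intro distr_cong refl) (simp add: F(3))
  ultimately show ?thesis by (simp add: SaS_rv_def)
qed

lemma expectation_sin: "Y \<in> lincombs \<Longrightarrow> (\<integral>\<omega>. sin (Y \<omega>) \<partial>M) = 0"
  by (rule SaS_rv_expectations(1)[OF prob_space_axioms lincombs_measurable alpha_pos lincombs_SaS])

lemma expectation_cos_scaled:
  "Y \<in> lincombs \<Longrightarrow> (\<integral>\<omega>. cos (2 powr (1 / \<alpha>) * Y \<omega>) \<partial>M) = (\<integral>\<omega>. cos (Y \<omega>) \<partial>M)\<^sup>2"
  by (rule SaS_rv_expectations(2)[OF prob_space_axioms lincombs_measurable alpha_pos lincombs_SaS])

text \<open>By the addition formula, since the sine part has mean zero.\<close>

lemma expectation_cos_phase:
  assumes "Y \<in> lincombs" shows "(\<integral>\<omega>. cos (Y \<omega> + b) \<partial>M) = cos b * (\<integral>\<omega>. cos (Y \<omega>) \<partial>M)"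
proof -
  have int: "integrable M (\<lambda>\<omega>. cos (Y \<omega>))" "integrable M (\<lambda>\<omega>. sin (Y \<omega>))"
    using lincombs_measurable[OF assms] by (auto intro: bdd_fun_integrable bdd_fun_cos bdd_fun_sin)
  then show ?thesis by (simp add: cos_add expectation_sin[OF assms])
qed

section \<open>The cosine defect and the squaring argument\<close>

text \<open>Joint characteristic function of \<open>Y\<close> and the shifted \<open>Z\<close> at
  (1, 1) minus the product of the marginal ones, all real by symmetry; it vanishes under
  independence.\<close>

definition cos_defect :: "('a \<Rightarrow> real) \<Rightarrow> ('a \<Rightarrow> real) \<Rightarrow> real^'d \<Rightarrow> real" where
  "cos_defect Y Z t = (if t \<in> Tset discr
    then (\<integral>\<omega>. cos (Y \<omega> + Z (\<theta> t \<omega>)) \<partial>M) - (\<integral>\<omega>. cos (Y \<omega>) \<partial>M) * (\<integral>\<omega>. cos (Z \<omega>) \<partial>M) else 0)"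

text \<open>Ergodicity speaks of products of \<open>f\<close> with a shifted \<open>g\<close>; the
  addition formula brings the defect into this form, and the means of the sines contribute
  nothing.\<close>

lemma cos_defect_eq_corr:
  assumes Y: "Y \<in> lincombs" and Z: "Z \<in> lincombs"
  shows "cos_defect Y Z = (\<lambda>t. corr (\<lambda>\<omega>. cos (Y \<omega>)) (\<lambda>\<omega>. cos (Z \<omega>)) t + (-1) * corr (\<lambda>\<omega>. sin (Y \<omega>)) (\<lambda>\<omega>. sin (Z \<omega>)) t)"
proof
  fix t
  note [intro] = bdd_fun_cos[OF lincombs_measurable_N[OF Y]] bdd_fun_cos[OF lincombs_measurable_N[OF Z]]
    bdd_fun_sin[OF lincombs_measurable_N[OF Y]] bdd_fun_sin[OF lincombs_measurable_N[OF Z]]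
  show "cos_defect Y Z t = corr (\<lambda>\<omega>. cos (Y \<omega>)) (\<lambda>\<omega>. cos (Z \<omega>)) t + (-1) * corr (\<lambda>\<omega>. sin (Y \<omega>)) (\<lambda>\<omega>. sin (Z \<omega>)) t"
  proof (cases "t \<in> Tset discr")
    case True
    have "integrable M (\<lambda>\<omega>. cos (Y \<omega>) * cos (Z (\<theta> t \<omega>)))" "integrable M (\<lambda>\<omega>. sin (Y \<omega>) * sin (Z (\<theta> t \<omega>)))"
      by (rule integrable_corr[OF _ _ True, of "\<lambda>\<omega>. cos (Y \<omega>)" "\<lambda>\<omega>. cos (Z \<omega>)"]; blast)
        (rule integrable_corr[OF _ _ True, of "\<lambda>\<omega>. sin (Y \<omega>)" "\<lambda>\<omega>. sin (Z \<omega>)"]; blast)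
    then show ?thesis using True by (simp add: cos_defect_def corr_def cos_add expectation_sin Y)
  qed (simp add: cos_defect_def corr_def)
qed

text \<open>Stability enters here: scaling by \<open>2 powr (1 / \<alpha>)\<close> squares characteristic functions, so the defect
  \<open>D\<close> of the scaled pair is \<open>d\<^sup>2 + 2 c d\<close> for the defect \<open>d\<close> of the original one. Ergodicity makes the
  averages of \<open>D\<close> and \<open>d\<close> vanish, hence those of \<open>d\<^sup>2\<close>.\<close>
lemma cesaro_null_cos_defect:
  assumes erg: "ergodic_action discr M \<theta> X" and Y: "Y \<in> lincombs" and Z: "Z \<in> lincombs"
  shows "cesaro_null discr (cos_defect Y Z)"
proof -
  have mz: "mean_zero discr (cos_defect Y' Z')" if "Y' \<in> lincombs" "Z' \<in> lincombs" for Y' Z'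
    unfolding cos_defect_eq_corr[OF that]
    by (intro mean_zero_add mean_zero_cmult ergodic_mean_zero_bdd[OF erg] bdd_fun_cos bdd_fun_sin lincombs_measurable_N that)
  define v where "v = 2 powr (1 / \<alpha>)"
  define c where "c = (\<integral>\<omega>. cos (Y \<omega>) \<partial>M) * (\<integral>\<omega>. cos (Z \<omega>) \<partial>M)"
  have "cos_defect (\<lambda>\<omega>. v * Y \<omega>) (\<lambda>\<omega>. v * Z \<omega>) t = (cos_defect Y Z t)\<^sup>2 + 2 * c * cos_defect Y Z t" for t
  proof (cases "t \<in> Tset discr")
    case True
    have "(\<integral>\<omega>. cos (v * Y \<omega> + v * Z (\<theta> t \<omega>)) \<partial>M) = (\<integral>\<omega>. cos (Y \<omega> + Z (\<theta> t \<omega>)) \<partial>M)\<^sup>2"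
      using expectation_cos_scaled[OF lincombs_add[OF Y lincombs_shift[OF Z True]]] by (simp add: v_def distrib_left)
    then show ?thesis using True expectation_cos_scaled[OF Y] expectation_cos_scaled[OF Z]
      by (simp add: cos_defect_def v_def[symmetric] c_def power2_eq_square algebra_simps)
  qed (simp add: cos_defect_def)
  then have "(\<lambda>t. (cos_defect Y Z t)\<^sup>2)
      = (\<lambda>t. cos_defect (\<lambda>\<omega>. v * Y \<omega>) (\<lambda>\<omega>. v * Z \<omega>) t + (- 2 * c) * cos_defect Y Z t)"
    by (auto simp: algebra_simps)
  then have "mean_zero discr (\<lambda>t. (cos_defect Y Z t)\<^sup>2)"
    using mean_zero_add[OF mz[OF lincombs_scale[OF Y] lincombs_scale[OF Z]] mean_zero_cmult[OF mz[OF Y Z]], of v v "- 2 * c"]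
    by simp
  moreover have "bdd_meas discr (cos_defect Y Z)" using mz[OF Y Z] by (simp add: mean_zero_def)
  ultimately show ?thesis by (intro cesaro_null_of_square)
qed

text \<open>Product-to-sum yields the combinations of \<open>Y\<close> with the shifted
  \<open>Z\<close> and \<open>- Z\<close>, and the phases factor out. The constants match because
  \<open>cos b * cos c\<close> is the mean of \<open>cos (b - c)\<close> and
  \<open>cos (b + c)\<close> and the cosine is even, so two defects suffice.\<close>

lemma cesaro_null_corr_cosines:
  assumes erg: "ergodic_action discr M \<theta> X" and f: "f \<in> cosines lincombs" and g: "g \<in> cosines lincombs"
  shows "cesaro_null discr (corr f g)"
proof -
  obtain Y b where Y: "Y \<in> lincombs" "f = (\<lambda>\<omega>. cos (Y \<omega> + b))" using f by (auto simp: cosines_def)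
  obtain Z c where Z: "Z \<in> lincombs" "g = (\<lambda>\<omega>. cos (Z \<omega> + c))" using g by (auto simp: cosines_def)
  let ?Z = "\<lambda>\<omega>. (-1) * Z \<omega>"
  have Z': "?Z \<in> lincombs" by (rule lincombs_scale[OF Z(1)])
  have "corr f g t = (cos (b - c) / 2) * cos_defect Y ?Z t + (cos (b + c) / 2) * cos_defect Y Z t" for t
  proof (cases "t \<in> Tset discr")
    case True
    have m: "(\<lambda>\<omega>. Y \<omega> + Z (\<theta> t \<omega>)) \<in> lincombs" "(\<lambda>\<omega>. Y \<omega> + ?Z (\<theta> t \<omega>)) \<in> lincombs"
      by (intro lincombs_add Y(1) lincombs_shift[OF Z(1)] lincombs_shift[OF Z'] True)+
    have int: "integrable M (\<lambda>\<omega>. (1/2) * cos (W \<omega> + a))" if "W \<in> lincombs" for W a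
      using lincombs_measurable[OF that] by (intro integrable_mult_right bdd_fun_integrable bdd_fun_cos) auto
    have "(\<integral>\<omega>. f \<omega> * g (\<theta> t \<omega>) \<partial>M)
      = (\<integral>\<omega>. (1/2) * cos ((Y \<omega> + ?Z (\<theta> t \<omega>)) + (b - c)) + (1/2) * cos ((Y \<omega> + Z (\<theta> t \<omega>)) + (b + c)) \<partial>M)"
      unfolding Y(2) Z(2) cos_times_cos
      by (intro Bochner_Integration.integral_cong refl) (simp add: algebra_simps add_divide_distrib)
    also have "\<dots> = (1/2) * (\<integral>\<omega>. cos ((Y \<omega> + ?Z (\<theta> t \<omega>)) + (b - c)) \<partial>M) + (1/2) * (\<integral>\<omega>. cos ((Y \<omega> + Z (\<theta> t \<omega>)) + (b + c)) \<partial>M)"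
      unfolding Bochner_Integration.integral_add[OF int[OF m(2), of "b - c"] int[OF m(1), of "b + c"]]
        integral_mult_right_zero ..
    also have "\<dots> = (1/2) * (cos (b - c) * (\<integral>\<omega>. cos (Y \<omega> + ?Z (\<theta> t \<omega>)) \<partial>M)) + (1/2) * (cos (b + c) * (\<integral>\<omega>. cos (Y \<omega> + Z (\<theta> t \<omega>)) \<partial>M))"
      unfolding expectation_cos_phase[OF m(1)] expectation_cos_phase[OF m(2)] ..
    finally have 1: "(\<integral>\<omega>. f \<omega> * g (\<theta> t \<omega>) \<partial>M) = \<dots>" .
    have 2: "(\<integral>\<omega>. f \<omega> \<partial>M) * (\<integral>\<omega>. g \<omega> \<partial>M) = (cos b * cos c) * ((\<integral>\<omega>. cos (Y \<omega>) \<partial>M) * (\<integral>\<omega>. cos (Z \<omega>) \<partial>M))"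
      unfolding Y(2) Z(2) expectation_cos_phase[OF Y(1)] expectation_cos_phase[OF Z(1)] by simp
    show ?thesis using True unfolding corr_def cos_defect_def 1 2 cos_times_cos
      by (simp add: field_simps)
  qed (simp add: corr_def cos_defect_def)
  then have "corr f g = (\<lambda>t. (cos (b - c) / 2) * cos_defect Y ?Z t + (cos (b + c) / 2) * cos_defect Y Z t)" by (rule ext)
  then show ?thesis
    by (simp only:) (intro cesaro_null_add cesaro_null_cmult cesaro_null_cos_defect[OF erg] Y(1) Z(1) Z')
qed

lemma ergodic_imp_weakly_mixing:
  assumes erg: "ergodic_action discr M \<theta> X"
  shows "weakly_mixing_action discr M \<theta> X"
proof (rule cesaro_null_imp_weakly_mixing)
  have closure: "indicator A \<in> L1_closure M (cosines lincombs)" if "A \<in> sets N" for A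
  proof (rule indicator_in_L1_closure_cosines)
    have "0 \<in> Tset discr" by (simp add: Tset_def)
    then show "lincombs \<noteq> {}" using X_lincombs by blast
    have "gens \<subseteq> {Y -` B \<inter> space M | Y B. Y \<in> lincombs \<and> B \<in> sets borel}"
      using X_lincombs by (auto simp: gens_def)
    from sigma_sets_mono'[OF this, of "space M"]
    show "A \<in> sigma_sets (space M) {Y -` B \<inter> space M | Y B. Y \<in> lincombs \<and> B \<in> sets borel}"
      using that unfolding sets_N_eq by (rule subsetD)
  qed (auto intro: lincombs_measurable lincombs_add lincombs_scale)
  fix A B assume A: "A \<in> sets N" and B: "B \<in> sets N"
  have bdd: "bdd_fun N g" if g: "g \<in> cosines lincombs" for g
  proof -
    obtain Y b where "Y \<in> lincombs" "g = (\<lambda>\<omega>. cos (Y \<omega> + b))" using g by (auto simp: cosines_def)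
    then show ?thesis
      using lincombs_measurable_N by (simp add: bdd_fun_cos[OF borel_measurable_add[OF _ borel_measurable_const]])
  qed
  show "cesaro_null discr (corr (indicator A) (indicator B))"
    by (rule corr_extend[OF cesaro_null_add cesaro_null_cmult cesaro_null_uniform_limit bdd
          cesaro_null_corr_cosines[OF erg] bdd_fun_indicator[OF A] closure[OF A] bdd_fun_indicator[OF B] closure[OF B]])
qed

end

theorem mainTheorem9:
  fixes discr :: bool
    and M :: "'a measure"
    and \<theta> :: "real^'d \<Rightarrow> 'a \<Rightarrow> 'a"
    and X0 :: "'a \<Rightarrow> real"
    and X :: "real^'d \<Rightarrow> 'a \<Rightarrow> real"
    and \<alpha> :: real
  assumes "prob_space M"
    and "0 < \<alpha>" and "\<alpha> < 2"
    and "mp_action discr M \<theta>"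
    and "X0 \<in> borel_measurable M"
    and "\<And>t \<omega>. X t \<omega> = X0 (\<theta> t \<omega>)"
    and "(\<lambda>(t, \<omega>). X t \<omega>) \<in> borel_measurable (idx_space discr \<Otimes>\<^sub>M M)"
    and "SaS_field discr \<alpha> M X"
  shows "ergodic_action discr M \<theta> X \<longleftrightarrow> weakly_mixing_action discr M \<theta> X"
proof -
  interpret prob_space M by fact
  interpret SaS_stationary_field M discr \<theta> X0 X \<alpha>
    by unfold_locales (use assms in auto)
  show ?thesis using ergodic_imp_weakly_mixing weakly_mixing_imp_ergodic by blast
qed

end
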